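(* On the set of the $512$ mesh patterns $(12,R)$, $R\subseteq\{0,1,2\}\times\{0,1,2\}$, the equivalence relation of coincidence under $321$ (that is, $p_1\sim p_2$ if and only if $\mathrm{Av}(\{321,p_1\})=\mathrm{Av}(\{321,p_2\})$) has exactly $213$ equivalence classes.
   Context: Write $[n]=\{1,\dots,n\}$. A permutation of length $n$ is a bijection of $[n]$, written in one-line notation; $G(\pi)=\{(i,\pi(i)) : i\in[n]\}$ is its plot. A mesh pattern of length $k$ is a pair $p=(\tau,R)$ with $\tau$ a permutation of length $k$ and $R\subseteq\{0,\dots,k\}^2$. An occurrence of $p$ in a permutation $\pi$ of length $n$ is a subset $\omega\subseteq G(\pi)$ for which there are order-preserving injections $\alpha,\beta:[k]\to[n]$ such that (i) $\omega=\{(\alpha(i),\beta(j)):(i,j)\in G(\tau)\}$, and (ii) with $\alpha(0)=\beta(0)=0$, $\alpha(k+1)=\beta(k+1)=n+1$ and $R_{ij}=[\alpha(i)+1,\alpha(i+1)-1]\times[\beta(j)+1,\beta(j+1)-1]$, one has $R_{ij}\cap G(\pi)=\emptyset$ for every $(i,j)\in R$. A permutation avoids $p$ if it has no occurrence of $p$. A classical pattern $\pi$ is identified with the mesh pattern $(\pi,\emptyset)$. $\mathrm{Av}(S)$ is the set of all permutations (of all lengths, including the empty one) avoiding every pattern in $S$. *)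

theory Defs
  imports "HOL-Combinatorics.Multiset_Permutations"
begin

text \<open>A permutation is given by its one-line notation, so the value at the 1-based position
  \<open>i\<close> is \<open>\<pi> ! (i - 1)\<close>. The empty list is the permutation of length 0.\<close>

definition is_perm :: "nat list \<Rightarrow> bool" where
  "is_perm \<pi> \<longleftrightarrow> \<pi> \<in> permutations_of_set {1..length \<pi>}"

definition plot :: "nat list \<Rightarrow> (nat \<times> nat) set" where
  "plot \<pi> = {(i, \<pi> ! (i - 1)) | i. i \<in> {1..length \<pi>}}"

type_synonym mesh_pattern = "nat list \<times> (nat \<times> nat) set"

definition is_mesh_pattern :: "mesh_pattern \<Rightarrow> bool" where
  "is_mesh_pattern p \<longleftrightarrow>
     (case p of (\<tau>, R) \<Rightarrow> is_perm \<tau> \<and> R \<subseteq> {0..length \<tau>} \<times> {0..length \<tau>})"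

definition classical :: "nat list \<Rightarrow> mesh_pattern" where
  "classical \<tau> = (\<tau>, {})"

text \<open>The maps \<open>\<alpha>\<close> and \<open>\<beta>\<close> carry their boundary values at \<open>0\<close> and \<open>k + 1\<close> with them; these are
  unconstrained by the monotonicity and injectivity conditions, which concern \<open>{1..k}\<close> only.
  Truncated subtraction is harmless since \<open>\<alpha> (i + 1)\<close> and \<open>\<beta> (j + 1)\<close> are at least 1.\<close>

definition is_occurrence :: "mesh_pattern \<Rightarrow> nat list \<Rightarrow> (nat \<times> nat) set \<Rightarrow> bool" where
  "is_occurrence p \<pi> \<omega> \<longleftrightarrow>
     (case p of (\<tau>, R) \<Rightarrow>
        let k = length \<tau>; n = length \<pi> in
        \<omega> \<subseteq> plot \<pi> \<and>
        (\<exists>\<alpha> \<beta> :: nat \<Rightarrow> nat.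
           \<alpha> ` {1..k} \<subseteq> {1..n} \<and> mono_on {1..k} \<alpha> \<and> inj_on \<alpha> {1..k} \<and>
           \<beta> ` {1..k} \<subseteq> {1..n} \<and> mono_on {1..k} \<beta> \<and> inj_on \<beta> {1..k} \<and>
           \<alpha> 0 = 0 \<and> \<beta> 0 = 0 \<and> \<alpha> (k + 1) = n + 1 \<and> \<beta> (k + 1) = n + 1 \<and>
           \<omega> = {(\<alpha> i, \<beta> j) | i j. (i, j) \<in> plot \<tau>} \<and>
           (\<forall>(i, j) \<in> R.
              ({\<alpha> i + 1..\<alpha> (i + 1) - 1} \<times> {\<beta> j + 1..\<beta> (j + 1) - 1}) \<inter> plot \<pi> = {})))"

definition avoids :: "nat list \<Rightarrow> mesh_pattern \<Rightarrow> bool" where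
  "avoids \<pi> p \<longleftrightarrow> \<not> (\<exists>\<omega>. is_occurrence p \<pi> \<omega>)"

definition Av :: "mesh_pattern set \<Rightarrow> nat list set" where
  "Av S = {\<pi>. is_perm \<pi> \<and> (\<forall>p \<in> S. avoids \<pi> p)}"

definition coincidence_under :: "nat list \<Rightarrow> mesh_pattern set \<Rightarrow> (mesh_pattern \<times> mesh_pattern) set" where
  "coincidence_under \<sigma> M =
     {(p\<^sub>1, p\<^sub>2). p\<^sub>1 \<in> M \<and> p\<^sub>2 \<in> M \<and> Av {classical \<sigma>, p\<^sub>1} = Av {classical \<sigma>, p\<^sub>2}}"

definition mesh_patterns_of :: "nat list \<Rightarrow> mesh_pattern set" where
  "mesh_patterns_of \<tau> = {p. is_mesh_pattern p \<and> fst p = \<tau>}"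

lemma mesh_patterns_of_12:
  "mesh_patterns_of [1, 2] = {([1, 2], R) | R. R \<subseteq> {0, 1, 2} \<times> {0, 1, 2}}"
proof -
  have "{0..length [1::nat, 2]} = {0, 1, 2}" and "{1..length [1::nat, 2]} = {1, 2}"
    by auto
  then show ?thesis
    by (auto simp: mesh_patterns_of_def is_mesh_pattern_def is_perm_def permutations_of_set_def)
qed

end

theory Submission
  imports Defs "HOL-Library.Sublist"
begin

text \<open>A coincidence is proved by two implications between containments. To deduce an occurrence of
  one pattern from an occurrence of another, one repeatedly asks whether some box of the grid
  through the points found so far is empty; if it is not, its extremal point in one of the four
  directions refines the grid and makes part of the box empty. Boxes in which a point would
  create \<open>321\<close> are empty anyway. For every coincidence a finite tree of such questions ends with an
  occurrence of the target in each leaf, so the proof amounts to checking these trees. Conversely,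
  21 permutations avoiding \<open>321\<close> of length at most 5 tell the remaining 213 patterns apart.\<close>

section \<open>Mesh patterns in a grid\<close>

text \<open>The obstacle is that a coincidence speaks of permutations of every length. A certificate
  never sees a length: it knows only the relative order of the finitely many points found so far and
  which boxes between them are empty, so checking it once settles all permutations. Extremal points
  keep the trees finite: an arbitrary point of a nonempty box would leave the status of all four
  quarters open, whereas an extremal one clears two of them. Avoidance of 321 enters through the
  inversions among the found points. Enlarging R makes an occurrence harder to find, so every
  pattern between two coinciding ones coincides with them, and a class can be described by its
  extremal members. The count 213 arises as 61 representatives of such classes plus 152 patterns
  that coincide with no other.\<close>

type_synonym cell = "nat \<times> nat"

definition box :: "(nat \<Rightarrow> nat) \<Rightarrow> (nat \<Rightarrow> nat) \<Rightarrow> cell \<Rightarrow> (nat \<times> nat) set" where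
  "box \<alpha> \<beta> c = {\<alpha> (fst c)<..<\<alpha> (Suc (fst c))} \<times> {\<beta> (snd c)<..<\<beta> (Suc (snd c))}"

lemma mem_box_iff:
  "(x, y) \<in> box \<alpha> \<beta> (i, j) \<longleftrightarrow> \<alpha> i < x \<and> x < \<alpha> (Suc i) \<and> \<beta> j < y \<and> y < \<beta> (Suc j)"
  by (auto simp: box_def)

text \<open>The grid arguments address points by their coordinates, so they are carried out for a
  point set with distinct coordinates instead of a list. \<open>N\<close> stands for n + 1, the
  place of the far boundary line.\<close>

locale plot_avoiding_321 =
  fixes P :: "(nat \<times> nat) set" and N :: nat
  assumes bounded: "P \<subseteq> {1..<N} \<times> {1..<N}"
    and unique_fst: "(x, y) \<in> P \<Longrightarrow> (x, y') \<in> P \<Longrightarrow> y = y'"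
    and unique_snd: "(x, y) \<in> P \<Longrightarrow> (x', y) \<in> P \<Longrightarrow> x = x'"
    and no_321: "(x1, y1) \<in> P \<Longrightarrow> (x2, y2) \<in> P \<Longrightarrow> (x3, y3) \<in> P \<Longrightarrow>
      x1 < x2 \<Longrightarrow> x2 < x3 \<Longrightarrow> y3 < y2 \<Longrightarrow> y2 < y1 \<Longrightarrow> False"
begin

text \<open>A grid whose line \<open>i\<close> is \<open>\<alpha> i\<close> (vertical) resp. \<open>\<beta> i\<close> (horizontal): line \<open>0\<close> and line
  \<open>length ps + 1\<close> bound the plot, each line in between carries exactly one of the points \<open>ps\<close>
  (given by grid coordinates), and the boxes in \<open>S\<close> contain no point of the plot. The lines beyond
  the boundary are irrelevant; they only make \<open>\<alpha>\<close> and \<open>\<beta>\<close> strictly monotone everywhere.\<close>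

definition embeds :: "(nat \<Rightarrow> nat) \<Rightarrow> (nat \<Rightarrow> nat) \<Rightarrow> cell list \<Rightarrow> cell list \<Rightarrow> bool" where
  "embeds \<alpha> \<beta> ps S \<longleftrightarrow>
     strict_mono \<alpha> \<and> strict_mono \<beta> \<and> \<alpha> 0 = 0 \<and> \<beta> 0 = 0 \<and>
     \<alpha> (Suc (length ps)) = N \<and> \<beta> (Suc (length ps)) = N \<and>
     (\<forall>(i, j) \<in> set ps. (\<alpha> i, \<beta> j) \<in> P) \<and>
     fst ` set ps = {1..length ps} \<and> snd ` set ps = {1..length ps} \<and>
     (\<forall>c \<in> set S. box \<alpha> \<beta> c \<inter> P = {})"

definition contains :: "cell list \<Rightarrow> bool" where
  "contains R \<longleftrightarrow> (\<exists>\<alpha> \<beta>. embeds \<alpha> \<beta> [(1, 1), (2, 2)] R)"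

lemma embeds_12_iff:
  "embeds \<alpha> \<beta> [(1, 1), (2, 2)] R \<longleftrightarrow>
     strict_mono \<alpha> \<and> strict_mono \<beta> \<and> \<alpha> 0 = 0 \<and> \<beta> 0 = 0 \<and> \<alpha> 3 = N \<and> \<beta> 3 = N \<and>
     (\<alpha> 1, \<beta> 1) \<in> P \<and> (\<alpha> 2, \<beta> 2) \<in> P \<and> (\<forall>c \<in> set R. box \<alpha> \<beta> c \<inter> P = {})"
proof -
  have "{1..length [(1::nat, 1::nat), (2, 2)]} = {1, 2}" by auto
  moreover have "Suc (length [(1::nat, 1::nat), (2, 2)]) = 3" by simp
  ultimately show ?thesis unfolding embeds_def by (simp only:) auto
qed

text \<open>The same two points serve: fewer boxes have to be empty. This is what lets a class be
  treated as a union of intervals in the subset order.\<close>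

lemma contains_mono:
  assumes "contains R" "set R' \<subseteq> set R"
  shows "contains R'"
proof -
  obtain \<alpha> \<beta> where "embeds \<alpha> \<beta> [(1, 1), (2, 2)] R" using assms(1) contains_def by auto
  then have "embeds \<alpha> \<beta> [(1, 1), (2, 2)] R'" using assms(2) unfolding embeds_12_iff by auto
  then show ?thesis using contains_def by auto
qed

end

section \<open>Refining a grid by one new point\<close>

definition insert_line :: "nat \<Rightarrow> nat \<Rightarrow> (nat \<Rightarrow> nat) \<Rightarrow> nat \<Rightarrow> nat" where
  "insert_line i x \<alpha> m = (if m \<le> i then \<alpha> m else if m = Suc i then x else \<alpha> (m - 1))"

definition shift_line :: "nat \<Rightarrow> nat \<Rightarrow> nat" where
  "shift_line i m = (if m \<le> i then m else Suc m)"

text \<open>Strip a lies between lines a and a + 1. A new line inside strip i receives index i + 1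
  and halves this strip only; the other strips survive, possibly renumbered.\<close>

definition split_strip :: "nat \<Rightarrow> nat \<Rightarrow> nat list" where
  "split_strip i a = (if a < i then [a] else if a = i then [a, Suc a] else [Suc a])"

lemma strict_mono_insert_line:
  assumes "strict_mono \<alpha>" "\<alpha> i < x" "x < \<alpha> (Suc i)"
  shows "strict_mono (insert_line i x \<alpha>)"
proof -
  have step: "\<alpha> n < \<alpha> (Suc n)" for n
    using assms(1) by (simp add: strict_mono_Suc_iff)
  have "insert_line i x \<alpha> n < insert_line i x \<alpha> (Suc n)" for n
  proof -
    consider "n < i" | "n = i" | "n = Suc i" | "n > Suc i" by linarith
    then show ?thesis
    proof cases
      case 4
      then show ?thesis using step[of "n - 1"] by (simp add: insert_line_def)
    qed (use assms step in \<open>auto simp: insert_line_def\<close>)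
  qed
  then show ?thesis by (simp add: strict_mono_Suc_iff)
qed

lemma insert_line_shift_line: "insert_line i x \<alpha> (shift_line i m) = \<alpha> m"
  by (simp add: insert_line_def shift_line_def)

text \<open>Each piece of a strip stays inside that strip, so a box known to be empty passes its
  emptiness on to all of its pieces.\<close>

lemma split_strip_bounds:
  assumes "strict_mono \<alpha>" "\<alpha> i < x" "x < \<alpha> (Suc i)" "a' \<in> set (split_strip i a)"
  shows "\<alpha> a \<le> insert_line i x \<alpha> a'" "insert_line i x \<alpha> (Suc a') \<le> \<alpha> (Suc a)"
  using assms by (auto simp: split_strip_def insert_line_def split: if_splits)

text \<open>The renumbered old lines miss exactly index i + 1, which the new line takes. Thus every
  inner line still carries a point after the refinement.\<close>

lemma shift_line_image: "insert (Suc i) (shift_line i ` {1..k}) = {1..Suc k}" if "i \<le> k"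
proof (intro equalityI subsetI)
  fix m assume m: "m \<in> {1..Suc k}"
  consider "m \<le> i" | "m = Suc i" | "m > Suc i" by linarith
  then show "m \<in> insert (Suc i) (shift_line i ` {1..k})"
  proof cases
    case 1
    then have "m = shift_line i m" by (simp add: shift_line_def)
    with 1 that m show ?thesis by (metis atLeastAtMost_iff imageI insertCI le_trans)
  next
    case 3
    then have "m = shift_line i (m - 1)" "m - 1 \<in> {1..k}" using m by (auto simp: shift_line_def)
    then show ?thesis by blast
  qed simp
qed (use that in \<open>auto simp: shift_line_def split: if_splits\<close>)

section \<open>Certificates for implications between patterns\<close>

datatype direction = West | East | South | North

text \<open>\<open>Split d c e t\<close> distinguishes whether box \<open>c\<close> contains points: if not, continue with \<open>e\<close>;
  otherwise add the point of the box that is extremal in direction \<open>d\<close> and continue with \<open>t\<close>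
  on the refined grid. \<open>Found u v\<close> claims that \<open>u\<close> and \<open>v\<close> form an occurrence of the target.\<close>

datatype certificate = Found cell cell | Split direction cell certificate certificate

text \<open>The cells are indexed in the refined grid, where the new point sits at (i + 1, j + 1)
  and the old box (i, j) has become four quarters. The two quarters on the extremal side contain no
  point.\<close>

fun beyond_extremal :: "direction \<Rightarrow> cell \<Rightarrow> cell list" where
  "beyond_extremal West (i, j) = [(i, j), (i, Suc j)]"
| "beyond_extremal East (i, j) = [(Suc i, j), (Suc i, Suc j)]"
| "beyond_extremal South (i, j) = [(i, j), (Suc i, j)]"
| "beyond_extremal North (i, j) = [(i, Suc j), (Suc i, Suc j)]"

definition insert_point :: "cell \<Rightarrow> cell list \<Rightarrow> cell list" where
  "insert_point c ps = (Suc (fst c), Suc (snd c)) #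
     map (\<lambda>p. (shift_line (fst c) (fst p), shift_line (snd c) (snd p))) ps"

definition refine :: "direction \<Rightarrow> cell \<Rightarrow> cell list \<Rightarrow> cell list" where
  "refine d c S = beyond_extremal d c @
     concat (map (\<lambda>s. List.product (split_strip (fst c) (fst s)) (split_strip (snd c) (snd s))) S)"

text \<open>The points u and w form an inversion, and the three alternatives make a point of box c
  the first, the middle or the last entry of a decreasing triple with them. Strict and weak
  comparisons mix because strip a lies to the right of line a and to the left of line a + 1.\<close>

definition creates_321 :: "cell list \<Rightarrow> cell \<Rightarrow> bool" where
  "creates_321 ps c \<longleftrightarrow> list_ex (\<lambda>u. list_ex (\<lambda>w.
     fst u < fst w \<and> snd w < snd u \<and>
      (fst c < fst u \<and> snd u \<le> snd c \<or>
       fst u \<le> fst c \<and> fst c < fst w \<and> snd w \<le> snd c \<and> snd c < snd u \<or>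
       fst w \<le> fst c \<and> snd c < snd w)) ps) ps"

text \<open>The grid lines through two points with coordinates \<open>a\<close> and \<open>b\<close>, as indices of lines in a
  finer grid bounded by line \<open>m\<close>.\<close>

definition coarse_line :: "nat \<Rightarrow> nat \<Rightarrow> nat \<Rightarrow> nat \<Rightarrow> nat" where
  "coarse_line a b m i = (if i = 0 then 0 else if i = 1 then a else if i = 2 then b else m + i - 3)"

lemma strict_mono_coarse_line:
  assumes "0 < a" "a < b" "b < m"
  shows "strict_mono (coarse_line a b m)"
  unfolding strict_mono_Suc_iff using assms by (auto simp: coarse_line_def)

text \<open>\<open>X\<close> and \<open>Y\<close> pick out the lines of the coarse grid through u
  and v among the fine lines. A shaded coarse box consists of open fine boxes and of pieces of fine
  lines. The test on \<open>ps\<close> deals with the lines, the test on fine cells with the rest.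
  The conditional spares the search for an inversion when the cell is already known to be
  empty.\<close>

definition occurrence_in_grid :: "cell list \<Rightarrow> cell list \<Rightarrow> cell list \<Rightarrow> cell \<Rightarrow> cell \<Rightarrow> bool" where
  "occurrence_in_grid R ps S u v \<longleftrightarrow>
     u \<in> set ps \<and> v \<in> set ps \<and> fst u < fst v \<and> snd u < snd v \<and>
     (let X = coarse_line (fst u) (fst v) (Suc (length ps));
          Y = coarse_line (snd u) (snd v) (Suc (length ps)) in
      list_all (\<lambda>(i, j).
        list_all (\<lambda>w. \<not> (X i < fst w \<and> fst w < X (Suc i) \<and> Y j < snd w \<and> snd w < Y (Suc j))) ps \<and>
        list_all (\<lambda>c. if c \<in> set S then True else creates_321 ps c)
          (List.product [X i..<X (Suc i)] [Y j..<Y (Suc j)])) R)"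

fun certifies :: "cell list \<Rightarrow> cell list \<Rightarrow> cell list \<Rightarrow> certificate \<Rightarrow> bool" where
  "certifies R ps S (Found u v) = occurrence_in_grid R ps S u v"
| "certifies R ps S (Split d c e t) =
     (certifies R ps (c # S) e \<and> certifies R (insert_point c ps) (refine d c S) t)"

lemma strip_of:
  fixes \<alpha> :: "nat \<Rightarrow> nat"
  assumes "strict_mono \<alpha>" "\<alpha> p < x" "x < \<alpha> q"
  obtains a where "p \<le> a" "a < q" "\<alpha> a \<le> x" "x < \<alpha> (Suc a)"
proof -
  \<comment> \<open>The least index whose next line lies beyond x. The strip obtained is closed on
    the left, so x may still lie on a line; that case has to be excluded by the user of the
    lemma.\<close>
  define a where "a = (LEAST a. x < \<alpha> (Suc a))"
  have ex: "x < \<alpha> (Suc q)"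
    using assms by (meson lessI less_trans strict_monoD)
  have up: "x < \<alpha> (Suc a)"
    unfolding a_def by (rule LeastI[where P = "\<lambda>a. x < \<alpha> (Suc a)", OF ex])
  have low: "\<alpha> a \<le> x"
  proof (cases a)
    case 0
    then show ?thesis
      using assms by (metis le0 less_imp_le order_trans strict_mono_less_eq)
  next
    case (Suc b)
    then have "\<not> x < \<alpha> (Suc b)"
      using not_less_Least[of b "\<lambda>a. x < \<alpha> (Suc a)"] unfolding a_def by simp
    then show ?thesis using Suc by simp
  qed
  have "p < Suc a" "a < q"
    using assms up low by (meson le_less_trans less_trans strict_mono_less)+
  then show thesis using up low by (intro that[of a]) simp_all
qed

section \<open>Soundness of certificates\<close>

context plot_avoiding_321
begin

lemma not_creates_321:
  assumes emb: "embeds \<alpha> \<beta> ps S" and z: "z \<in> P" "z \<in> box \<alpha> \<beta> c"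
  shows "\<not> creates_321 ps c"
proof
  assume "creates_321 ps c"
  then obtain u w where uw: "u \<in> set ps" "w \<in> set ps" "fst u < fst w" "snd w < snd u"
    and pos: "fst c < fst u \<and> snd u \<le> snd c \<or>
       fst u \<le> fst c \<and> fst c < fst w \<and> snd w \<le> snd c \<and> snd c < snd u \<or>
       fst w \<le> fst c \<and> snd c < snd w"
    by (auto simp: creates_321_def list_ex_iff)
  obtain i j where c: "c = (i, j)" by (cases c)
  obtain x y where xy: "z = (x, y)" by (cases z)
  have mono: "strict_mono \<alpha>" "strict_mono \<beta>" using emb by (auto simp: embeds_def)
  have U: "(\<alpha> (fst u), \<beta> (snd u)) \<in> P" and W: "(\<alpha> (fst w), \<beta> (snd w)) \<in> P"
    using emb uw by (auto simp: embeds_def)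
  have Z: "(x, y) \<in> P" using z xy by simp
  have uw': "\<alpha> (fst u) < \<alpha> (fst w)" "\<beta> (snd w) < \<beta> (snd u)"
    using mono uw by (auto simp: strict_mono_less)
  have zb: "\<alpha> i < x" "x < \<alpha> (Suc i)" "\<beta> j < y" "y < \<beta> (Suc j)"
    using z xy c by (auto simp: mem_box_iff)
  have right: "\<alpha> a < x" if "a \<le> i" for a
    using that mono zb by (meson le_less_trans strict_mono_less_eq)
  have left: "x < \<alpha> a" if "i < a" for a
    using that mono zb by (meson Suc_leI less_le_trans strict_mono_less_eq)
  have above: "\<beta> a < y" if "a \<le> j" for a
    using that mono zb by (meson le_less_trans strict_mono_less_eq)
  have below: "y < \<beta> a" if "j < a" for a
    using that mono zb by (meson Suc_leI less_le_trans strict_mono_less_eq)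
  from pos show False
    using no_321[OF Z U W] no_321[OF U Z W] no_321[OF U W Z] uw' left right above below
    unfolding c by auto
qed

text \<open>A plot point in a shaded coarse box would lie either on a fine line or in an open fine
  box. On a line it would be the known point of that line, by distinctness of coordinates, and known
  points were checked; in a fine box it would contradict emptiness or complete a 321.\<close>

lemma contains_if_occurrence_in_grid:
  assumes emb: "embeds \<alpha> \<beta> ps S" and occ: "occurrence_in_grid R ps S u v"
  shows "contains R"
proof -
  define X where "X = coarse_line (fst u) (fst v) (Suc (length ps))"
  define Y where "Y = coarse_line (snd u) (snd v) (Suc (length ps))"
  have mono: "strict_mono \<alpha>" "strict_mono \<beta>" and zero: "\<alpha> 0 = 0" "\<beta> 0 = 0"
    and last: "\<alpha> (Suc (length ps)) = N" "\<beta> (Suc (length ps)) = N"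
    and pts: "\<And>w. w \<in> set ps \<Longrightarrow> (\<alpha> (fst w), \<beta> (snd w)) \<in> P"
    and fsts: "fst ` set ps = {1..length ps}" and snds: "snd ` set ps = {1..length ps}"
    and empty: "\<And>c. c \<in> set S \<Longrightarrow> box \<alpha> \<beta> c \<inter> P = {}"
    using emb by (auto simp: embeds_def)
  have uv: "u \<in> set ps" "v \<in> set ps" "fst u < fst v" "snd u < snd v"
    using occ by (auto simp: occurrence_in_grid_def)
  have no_pt: "\<not> (X i < fst w \<and> fst w < X (Suc i) \<and> Y j < snd w \<and> snd w < Y (Suc j))"
    if "(i, j) \<in> set R" "w \<in> set ps" for i j w
    using occ that by (auto simp: occurrence_in_grid_def X_def Y_def Let_def list_all_iff)
  have fine: "c \<in> set S \<or> creates_321 ps c"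
    if "(i, j) \<in> set R" "fst c \<in> {X i..<X (Suc i)}" "snd c \<in> {Y j..<Y (Suc j)}" for i j c
    using occ that
    by (cases c) (fastforce simp: occurrence_in_grid_def X_def Y_def Let_def list_all_iff split: if_splits)
  have range: "0 < fst u" "fst v < Suc (length ps)" "0 < snd u" "snd v < Suc (length ps)"
    using uv fsts snds by (metis Suc_le_eq One_nat_def atLeastAtMost_iff image_eqI less_Suc_eq_le)+
  have X: "strict_mono X" and Y: "strict_mono Y"
    unfolding X_def Y_def using uv range by (simp_all add: strict_mono_coarse_line)
  have "embeds (\<alpha> \<circ> X) (\<beta> \<circ> Y) [(1, 1), (2, 2)] R"
  proof -
    have "box (\<alpha> \<circ> X) (\<beta> \<circ> Y) (i, j) \<inter> P = {}" if R: "(i, j) \<in> set R" for i j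
    proof (rule ccontr)
      assume "\<not> ?thesis"
      then obtain x y where z: "(x, y) \<in> P" and
        b: "\<alpha> (X i) < x" "x < \<alpha> (X (Suc i))" "\<beta> (Y j) < y" "y < \<beta> (Y (Suc j))"
        by (auto simp: box_def)
      have N: "x < N" "y < N" using z bounded by auto
      obtain a where a: "X i \<le> a" "a < X (Suc i)" "\<alpha> a \<le> x" "x < \<alpha> (Suc a)"
        using strip_of[OF mono(1) b(1,2)] .
      obtain d where d: "Y j \<le> d" "d < Y (Suc j)" "\<beta> d \<le> y" "y < \<beta> (Suc d)"
        using strip_of[OF mono(2) b(3,4)] .
      have on_line: False if w: "w \<in> set ps" "(x, y) = (\<alpha> (fst w), \<beta> (snd w))" for w
        using no_pt[OF R w(1)] b w(2) mono by (auto simp: strict_mono_less)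
      have "\<alpha> a \<noteq> x"
      proof
        assume eq: "\<alpha> a = x"
        \<comment> \<open>Line \<open>a\<close> is not a boundary line, as x lies strictly between 0
          and \<open>N\<close>; hence some known point lies on it.\<close>
        have "a \<in> {1..length ps}"
          using eq b N zero last mono by (metis One_nat_def Suc_leI atLeastAtMost_iff gr0I less_Suc_eq_le
            not_less_zero strict_mono_less)
        then obtain w where "w \<in> set ps" "a = fst w" using fsts by (metis imageE)
        then show False using on_line[of w] pts[of w] unique_fst z eq by auto
      qed
      moreover have "\<beta> d \<noteq> y"
      proof
        assume eq: "\<beta> d = y"
        have "d \<in> {1..length ps}"
          using eq b N zero last mono by (metis One_nat_def Suc_leI atLeastAtMost_iff gr0I less_Suc_eq_le
            not_less_zero strict_mono_less)
        then obtain w where "w \<in> set ps" "d = snd w" using snds by (metis imageE)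
        then show False using on_line[of w] pts[of w] unique_snd z eq by auto
      qed
      ultimately have "(x, y) \<in> box \<alpha> \<beta> (a, d)" using a d by (simp add: mem_box_iff)
      moreover from fine[OF R, of "(a, d)"] have "(a, d) \<in> set S \<or> creates_321 ps (a, d)"
        using a d by simp
      ultimately show False using not_creates_321[OF emb z] empty z by blast
    qed
    moreover have "strict_mono (\<alpha> \<circ> X)" "strict_mono (\<beta> \<circ> Y)"
      using mono X Y by (simp_all add: strict_mono_o)
    moreover have "(\<alpha> \<circ> X) 0 = 0" "(\<beta> \<circ> Y) 0 = 0" "(\<alpha> \<circ> X) 3 = N" "(\<beta> \<circ> Y) 3 = N"
      using zero last by (simp_all add: X_def Y_def coarse_line_def)
    moreover have "((\<alpha> \<circ> X) 1, (\<beta> \<circ> Y) 1) \<in> P" "((\<alpha> \<circ> X) 2, (\<beta> \<circ> Y) 2) \<in> P"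
      using pts uv by (simp_all add: X_def Y_def coarse_line_def)
    ultimately show ?thesis unfolding embeds_12_iff by auto
  qed
  then show ?thesis unfolding contains_def by blast
qed

lemma finite_plot: "finite P"
  using bounded by (rule finite_subset) simp

lemma ex_extremal:
  assumes "z \<in> P" "z \<in> B"
  obtains z' where "z' \<in> P" "z' \<in> B" "\<And>w. w \<in> P \<Longrightarrow> w \<in> B \<Longrightarrow>
    (case d of West \<Rightarrow> fst z' \<le> fst w | East \<Rightarrow> fst w \<le> fst z'
      | South \<Rightarrow> snd z' \<le> snd w | North \<Rightarrow> snd w \<le> snd z')"
proof -
  \<comment> \<open>Integer keys reduce all four directions to one minimization, the negated ones
    giving East and North.\<close>
  define key :: "nat \<times> nat \<Rightarrow> int" where
    "key w = (case d of West \<Rightarrow> int (fst w) | East \<Rightarrow> - int (fst w)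
      | South \<Rightarrow> int (snd w) | North \<Rightarrow> - int (snd w))" for w
  have "finite (P \<inter> B)" "P \<inter> B \<noteq> {}" using finite_plot assms by auto
  then obtain z' where "is_arg_min key (\<lambda>w. w \<in> P \<inter> B) z'"
    using ex_is_arg_min_if_finite by blast
  then show thesis
    by (intro that[of z']) (auto simp: is_arg_min_linorder key_def split: direction.splits)
qed

lemma embeds_refine:
  assumes emb: "embeds \<alpha> \<beta> ps S" and z: "z \<in> P" "z \<in> box \<alpha> \<beta> c"
    and ext: "\<And>w. w \<in> P \<Longrightarrow> w \<in> box \<alpha> \<beta> c \<Longrightarrow>
      (case d of West \<Rightarrow> fst z \<le> fst w | East \<Rightarrow> fst w \<le> fst z
        | South \<Rightarrow> snd z \<le> snd w | North \<Rightarrow> snd w \<le> snd z)"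
  shows "embeds (insert_line (fst c) (fst z) \<alpha>) (insert_line (snd c) (snd z) \<beta>)
    (insert_point c ps) (refine d c S)"
proof -
  obtain i j where c: "c = (i, j)" by (cases c)
  obtain x y where xy: "z = (x, y)" by (cases z)
  let ?\<alpha> = "insert_line i x \<alpha>" and ?\<beta> = "insert_line j y \<beta>"
  have mono: "strict_mono \<alpha>" "strict_mono \<beta>" and zero: "\<alpha> 0 = 0" "\<beta> 0 = 0"
    and last: "\<alpha> (Suc (length ps)) = N" "\<beta> (Suc (length ps)) = N"
    and pts: "\<And>w. w \<in> set ps \<Longrightarrow> (\<alpha> (fst w), \<beta> (snd w)) \<in> P"
    and fsts: "fst ` set ps = {1..length ps}" and snds: "snd ` set ps = {1..length ps}"
    and empty: "\<And>c. c \<in> set S \<Longrightarrow> box \<alpha> \<beta> c \<inter> P = {}"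
    using emb by (auto simp: embeds_def)
  have xb: "\<alpha> i < x" "x < \<alpha> (Suc i)" and yb: "\<beta> j < y" "y < \<beta> (Suc j)"
    using z c xy by (auto simp: mem_box_iff)
  have N: "x < N" "y < N" using z xy bounded by auto
  have ij: "i \<le> length ps" "j \<le> length ps"
    using N xb yb last mono by (metis less_Suc_eq_le less_trans strict_mono_less)+
  have boxes: "box ?\<alpha> ?\<beta> s \<inter> P = {}" if s: "s \<in> set (refine d c S)" for s
  proof (rule ccontr)
    assume "\<not> ?thesis"
    then obtain p q where w: "(p, q) \<in> P" "(p, q) \<in> box ?\<alpha> ?\<beta> s" by auto
    obtain a b where ab: "s = (a, b)" by (cases s)
    have wb: "?\<alpha> a < p" "p < ?\<alpha> (Suc a)" "?\<beta> b < q" "q < ?\<beta> (Suc b)"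
      using w ab by (auto simp: mem_box_iff)
    consider (old) "s \<in> set (beyond_extremal d c)"
      | (new) a' b' where "(a', b') \<in> set S" "a \<in> set (split_strip i a')" "b \<in> set (split_strip j b')"
      using s ab c by (auto simp: refine_def)
    then show False
    proof cases
      \<comment> \<open>A point in such a quarter would belong to the old box \<open>c\<close> and
        lie strictly beyond the extremal point z.\<close>
      case old
      then have "(p, q) \<in> box \<alpha> \<beta> c"
        using wb xb yb ab c by (cases d) (auto simp: mem_box_iff insert_line_def)
      from ext[OF w(1) this] show False
        using old wb xb yb ab c xy by (cases d) (auto simp: insert_line_def)
    next
      case new
      then have "(p, q) \<in> box \<alpha> \<beta> (a', b')"
        using wb split_strip_bounds[OF mono(1) xb new(2)] split_strip_bounds[OF mono(2) yb new(3)]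
        by (auto simp: mem_box_iff)
      then show False using empty[OF new(1)] w by blast
    qed
  qed
  have "fst ` set (insert_point c ps) = insert (Suc i) (shift_line i ` fst ` set ps)"
    "snd ` set (insert_point c ps) = insert (Suc j) (shift_line j ` snd ` set ps)"
    using c by (auto simp: insert_point_def image_image)
  then have coords: "fst ` set (insert_point c ps) = {1..Suc (length ps)}"
    "snd ` set (insert_point c ps) = {1..Suc (length ps)}"
    using fsts snds shift_line_image ij by simp_all
  have len: "length (insert_point c ps) = Suc (length ps)" by (simp add: insert_point_def)
  have points: "(?\<alpha> (fst w), ?\<beta> (snd w)) \<in> P" if "w \<in> set (insert_point c ps)" for w
    using that z pts c xy by (auto simp: insert_point_def insert_line_shift_line)
      (auto simp: insert_line_def)
  have "?\<alpha> 0 = 0" "?\<beta> 0 = 0" "?\<alpha> (Suc (Suc (length ps))) = N" "?\<beta> (Suc (Suc (length ps))) = N"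
    using zero last ij by (auto simp: insert_line_def)
  then show ?thesis
    using coords boxes points len strict_mono_insert_line[OF mono(1) xb]
      strict_mono_insert_line[OF mono(2) yb] c xy
    unfolding embeds_def by auto
qed

text \<open>Induction on the tree, for all grids at once, since the branch of a nonempty box
  continues on a refined grid. An extremal point of such a box exists because the plot is
  finite.\<close>

lemma certifies_sound:
  assumes "certifies R ps S t" "embeds \<alpha> \<beta> ps S"
  shows "contains R"
  using assms
proof (induction t arbitrary: \<alpha> \<beta> ps S)
  case (Found u v)
  then show ?case using contains_if_occurrence_in_grid by simp
next
  case (Split d c e t)
  show ?case
  proof (cases "box \<alpha> \<beta> c \<inter> P = {}")
    case True
    then have "embeds \<alpha> \<beta> ps (c # S)" using Split.prems by (simp add: embeds_def)
    with Split.IH(1) Split.prems(1) show ?thesis by auto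
  next
    case False
    then obtain z0 where "z0 \<in> P" "z0 \<in> box \<alpha> \<beta> c" by auto
    then obtain z where "z \<in> P" "z \<in> box \<alpha> \<beta> c" and "\<And>w. w \<in> P \<Longrightarrow> w \<in> box \<alpha> \<beta> c \<Longrightarrow>
      (case d of West \<Rightarrow> fst z \<le> fst w | East \<Rightarrow> fst w \<le> fst z
        | South \<Rightarrow> snd z \<le> snd w | North \<Rightarrow> snd w \<le> snd z)"
      by (rule ex_extremal[where d = d]) blast
    from embeds_refine[OF Split.prems(2) this] show ?thesis
      using Split.IH(2) Split.prems(1) by auto
  qed
qed

lemma contains_if_certifies:
  assumes "certifies R' [(1, 1), (2, 2)] R t" "contains R"
  shows "contains R'"
  using assms(2) certifies_sound[OF assms(1)] by (auto simp: contains_def)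

end

section \<open>Permutations as plots\<close>

lemma mem_plot_iff: "(x, y) \<in> plot \<pi> \<longleftrightarrow> 1 \<le> x \<and> x \<le> length \<pi> \<and> y = \<pi> ! (x - 1)"
  by (auto simp: plot_def)

lemma plot_image: "plot \<pi> = (\<lambda>i. (i, \<pi> ! (i - 1))) ` {1..length \<pi>}"
  by (auto simp: plot_def)

lemma plot_12: "plot [1, 2] = {(1, 1), (2, 2)}"
proof -
  have "{1..length [1::nat, 2]} = {1, 2}" by auto
  then show ?thesis unfolding plot_image by (simp only:) simp
qed

lemma plot_321: "plot [3, 2, 1] = {(1, 3), (2, 2), (3, 1)}"
proof -
  have "{1..length [3::nat, 2, 1]} = {1, 2, 3}" by auto
  then show ?thesis unfolding plot_image by (simp only:) simp
qed

lemma occurrence_points_12: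
  "{(\<alpha> i, \<beta> j) | i j. (i, j) \<in> plot [1, 2]} = {(\<alpha> 1, \<beta> 1), (\<alpha> 2, \<beta> 2)}"
  unfolding plot_12 by auto

lemma occurrence_points_321:
  "{(\<alpha> i, \<beta> j) | i j. (i, j) \<in> plot [3, 2, 1]} = {(\<alpha> 1, \<beta> 3), (\<alpha> 2, \<beta> 2), (\<alpha> 3, \<beta> 1)}"
  unfolding plot_321 by auto

lemma mono_on_inj_on_less:
  fixes f :: "nat \<Rightarrow> nat"
  assumes "mono_on A f" "inj_on f A" "i \<in> A" "j \<in> A" "i < j"
  shows "f i < f j"
  using assms by (metis inj_on_eq_iff le_neq_implies_less less_imp_le mono_onD nat_neq_iff)

lemma is_perm_plot:
  assumes "is_perm \<pi>"
  shows "plot \<pi> \<subseteq> {1..length \<pi>} \<times> {1..length \<pi>}"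
    and "(x, y) \<in> plot \<pi> \<Longrightarrow> (x', y) \<in> plot \<pi> \<Longrightarrow> x = x'"
proof -
  have \<pi>: "set \<pi> = {1..length \<pi>}" "distinct \<pi>"
    using assms by (auto simp: is_perm_def permutations_of_set_def)
  have "\<pi> ! (x - 1) \<in> {1..length \<pi>}" if "1 \<le> x" "x \<le> length \<pi>" for x
    unfolding \<pi>(1)[symmetric] using that by (intro nth_mem) simp
  then show "plot \<pi> \<subseteq> {1..length \<pi>} \<times> {1..length \<pi>}"
    by (force simp: plot_def)
  show "(x, y) \<in> plot \<pi> \<Longrightarrow> (x', y) \<in> plot \<pi> \<Longrightarrow> x = x'"
    using nth_eq_iff_index_eq[OF \<pi>(2), of "x - 1" "x' - 1"] by (simp add: mem_plot_iff) linarith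
qed

lemma avoids_321_iff:
  assumes "is_perm \<pi>"
  shows "avoids \<pi> (classical [3, 2, 1]) \<longleftrightarrow>
    \<not> (\<exists>x1 y1 x2 y2 x3 y3. (x1, y1) \<in> plot \<pi> \<and> (x2, y2) \<in> plot \<pi> \<and> (x3, y3) \<in> plot \<pi> \<and>
      x1 < x2 \<and> x2 < x3 \<and> y3 < y2 \<and> y2 < y1)"
proof
  assume av: "avoids \<pi> (classical [3, 2, 1])"
  show "\<not> (\<exists>x1 y1 x2 y2 x3 y3. (x1, y1) \<in> plot \<pi> \<and> (x2, y2) \<in> plot \<pi> \<and> (x3, y3) \<in> plot \<pi> \<and>
      x1 < x2 \<and> x2 < x3 \<and> y3 < y2 \<and> y2 < y1)"
  proof
    assume "\<exists>x1 y1 x2 y2 x3 y3. (x1, y1) \<in> plot \<pi> \<and> (x2, y2) \<in> plot \<pi> \<and> (x3, y3) \<in> plot \<pi> \<and>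
      x1 < x2 \<and> x2 < x3 \<and> y3 < y2 \<and> y2 < y1"
    then obtain x1 y1 x2 y2 x3 y3 where
      p: "(x1, y1) \<in> plot \<pi>" "(x2, y2) \<in> plot \<pi>" "(x3, y3) \<in> plot \<pi>"
      and o: "x1 < x2" "x2 < x3" "y3 < y2" "y2 < y1" by blast
    \<comment> \<open>Both maps have to be increasing, so \<beta> lists the values from below:
      \<beta> 1 is y3 and \<beta> 3 is y1. Index 4 = k + 1 receives the boundary value
      \<open>length \<pi> + 1\<close>.\<close>
    define \<alpha> where "\<alpha> = (\<lambda>i::nat. if i = 0 then 0 else if i = 1 then x1 else if i = 2 then x2
      else if i = 3 then x3 else length \<pi> + 1)"
    define \<beta> where "\<beta> = (\<lambda>i::nat. if i = 0 then 0 else if i = 1 then y3 else if i = 2 then y2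
      else if i = 3 then y1 else length \<pi> + 1)"
    have b: "{x1, x2, x3, y1, y2, y3} \<subseteq> {1..length \<pi>}"
      using p is_perm_plot(1)[OF assms] by blast
    have s: "{1..length [3::nat, 2, 1]} = {1, 2, 3}" by auto
    have "is_occurrence (classical [3, 2, 1]) \<pi> {(\<alpha> 1, \<beta> 3), (\<alpha> 2, \<beta> 2), (\<alpha> 3, \<beta> 1)}"
      unfolding is_occurrence_def classical_def prod.case Let_def occurrence_points_321 s
    proof (rule conjI, goal_cases)
      case 1
      show ?case using p by (auto simp: \<alpha>_def \<beta>_def)
    next
      case 2
      show ?case
      proof (rule exI[of _ \<alpha>], rule exI[of _ \<beta>], intro conjI)
        show "mono_on {1, 2, 3} \<alpha>" "inj_on \<alpha> {1, 2, 3}" "mono_on {1, 2, 3} \<beta>" "inj_on \<beta> {1, 2, 3}"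
          using o by (auto simp: mono_on_def inj_on_def \<alpha>_def \<beta>_def)
      qed (use b in \<open>auto simp: \<alpha>_def \<beta>_def\<close>)
    qed
    with av show False by (auto simp: avoids_def)
  qed
next
  assume no: "\<not> (\<exists>x1 y1 x2 y2 x3 y3. (x1, y1) \<in> plot \<pi> \<and> (x2, y2) \<in> plot \<pi> \<and> (x3, y3) \<in> plot \<pi> \<and>
      x1 < x2 \<and> x2 < x3 \<and> y3 < y2 \<and> y2 < y1)"
  have s: "{1..length [3::nat, 2, 1]} = {1, 2, 3}" by auto
  have False if occ: "is_occurrence (classical [3, 2, 1]) \<pi> \<omega>" for \<omega>
  proof -
    from occ obtain \<alpha> \<beta> :: "nat \<Rightarrow> nat" where w: "\<omega> \<subseteq> plot \<pi>" "\<omega> = {(\<alpha> 1, \<beta> 3), (\<alpha> 2, \<beta> 2), (\<alpha> 3, \<beta> 1)}"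
      and mono: "mono_on {1, 2, 3} \<alpha>" "inj_on \<alpha> {1, 2, 3}" "mono_on {1, 2, 3} \<beta>" "inj_on \<beta> {1, 2, 3}"
      unfolding is_occurrence_def classical_def prod.case Let_def occurrence_points_321 s
      by (elim conjE exE) (rule that; assumption)
    have "(\<alpha> 1, \<beta> 3) \<in> plot \<pi>" "(\<alpha> 2, \<beta> 2) \<in> plot \<pi>" "(\<alpha> 3, \<beta> 1) \<in> plot \<pi>"
      using w by auto
    moreover have "\<alpha> 1 < \<alpha> 2" "\<alpha> 2 < \<alpha> 3" "\<beta> 1 < \<beta> 2" "\<beta> 2 < \<beta> 3"
      using mono by (auto intro: mono_on_inj_on_less)
    ultimately show False using no by blast
  qed
  then show "avoids \<pi> (classical [3, 2, 1])" by (auto simp: avoids_def)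
qed

definition avoids_321 :: "nat list \<Rightarrow> bool" where
  "avoids_321 \<pi> \<longleftrightarrow> is_perm \<pi> \<and> avoids \<pi> (classical [3, 2, 1])"

lemma plot_avoiding_321_plot:
  assumes "avoids_321 \<pi>"
  shows "plot_avoiding_321 (plot \<pi>) (Suc (length \<pi>))"
proof (rule plot_avoiding_321.intro)
  have p: "is_perm \<pi>" using assms by (simp add: avoids_321_def)
  have "{1..<Suc (length \<pi>)} = {1..length \<pi>}" by auto
  then show "plot \<pi> \<subseteq> {1..<Suc (length \<pi>)} \<times> {1..<Suc (length \<pi>)}"
    using is_perm_plot(1)[OF p] by simp
  show "y = y'" if "(x, y) \<in> plot \<pi>" "(x, y') \<in> plot \<pi>" for x y y'
    using that by (simp add: mem_plot_iff)
  show "x = x'" if "(x, y) \<in> plot \<pi>" "(x', y) \<in> plot \<pi>" for x x' y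
    using that is_perm_plot(2)[OF p] by blast
  show False if "(x1, y1) \<in> plot \<pi>" "(x2, y2) \<in> plot \<pi>" "(x3, y3) \<in> plot \<pi>"
    "x1 < x2" "x2 < x3" "y3 < y2" "y2 < y1" for x1 y1 x2 y2 x3 y3
    using that avoids_321_iff[OF p] assms unfolding avoids_321_def by blast
qed

definition cells :: "cell list" where
  "cells = List.product [0, 1, 2] [0, 1, 2]"

lemma set_cells: "set cells = {0, 1, 2} \<times> {0, 1, 2}"
  by (auto simp: cells_def)

text \<open>This links the original notion of occurrence to grids. The two differ in that an
  occurrence constrains its maps on 0, ..., 3 only, while the lines of a grid increase
  everywhere.\<close>

lemma avoids_12_iff:
  assumes av: "avoids_321 \<pi>" and R: "set R \<subseteq> set cells"
  shows "avoids \<pi> ([1, 2], set R) \<longleftrightarrow>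
    \<not> plot_avoiding_321.contains (plot \<pi>) (Suc (length \<pi>)) R"
proof -
  interpret plot_avoiding_321 "plot \<pi>" "Suc (length \<pi>)"
    using av by (rule plot_avoiding_321_plot)
  have s: "{1..length [1::nat, 2]} = {1, 2}" and l: "length [1::nat, 2] + 1 = 3" by auto
  have box_eq: "{\<alpha> i + 1..\<alpha> (i + 1) - 1} \<times> {\<beta> j + 1..\<beta> (j + 1) - 1} = box \<alpha> \<beta> (i, j)"
    for \<alpha> \<beta> :: "nat \<Rightarrow> nat" and i j by (auto simp: box_def)
  have "(\<exists>\<omega>. is_occurrence ([1, 2], set R) \<pi> \<omega>) \<longleftrightarrow> contains R"
  proof
    assume "\<exists>\<omega>. is_occurrence ([1, 2], set R) \<pi> \<omega>"
    then obtain \<omega> and \<alpha> \<beta> :: "nat \<Rightarrow> nat" where w: "\<omega> \<subseteq> plot \<pi>" "\<omega> = {(\<alpha> 1, \<beta> 1), (\<alpha> 2, \<beta> 2)}"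
      and mono: "mono_on {1, 2} \<alpha>" "inj_on \<alpha> {1, 2}" "mono_on {1, 2} \<beta>" "inj_on \<beta> {1, 2}"
      and ends: "\<alpha> 0 = 0" "\<beta> 0 = 0" "\<alpha> 3 = length \<pi> + 1" "\<beta> 3 = length \<pi> + 1"
      and empty: "\<forall>(i, j) \<in> set R. box \<alpha> \<beta> (i, j) \<inter> plot \<pi> = {}"
      unfolding is_occurrence_def prod.case Let_def occurrence_points_12 s l box_eq
      by (elim conjE exE) (rule that; assumption)
    have p: "(\<alpha> 1, \<beta> 1) \<in> plot \<pi>" "(\<alpha> 2, \<beta> 2) \<in> plot \<pi>" using w by auto
    have lt: "\<alpha> 1 < \<alpha> 2" "\<beta> 1 < \<beta> 2"
      using mono by (auto intro: mono_on_inj_on_less)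
    have pos: "0 < \<alpha> 1" "0 < \<beta> 1" "\<alpha> 2 < Suc (length \<pi>)" "\<beta> 2 < Suc (length \<pi>)"
      using p bounded by auto
    define X where "X = coarse_line (\<alpha> 1) (\<alpha> 2) (Suc (length \<pi>))"
    define Y where "Y = coarse_line (\<beta> 1) (\<beta> 2) (Suc (length \<pi>))"
    have "X i = \<alpha> i" "Y i = \<beta> i" if "i \<le> 3" for i
      using that ends by (auto simp: X_def Y_def coarse_line_def le_Suc_eq numeral_3_eq_3 numeral_2_eq_2)
    then have same_box: "box X Y c = box \<alpha> \<beta> c" if "c \<in> set cells" for c
      using that by (auto simp: set_cells box_def)
    have "\<forall>c \<in> set R. box X Y c \<inter> plot \<pi> = {}"
    proof
      fix c assume "c \<in> set R"
      with R have "box X Y c = box \<alpha> \<beta> c" by (intro same_box) blast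
      with empty \<open>c \<in> set R\<close> show "box X Y c \<inter> plot \<pi> = {}" by (cases c) auto
    qed
    then have "embeds X Y [(1, 1), (2, 2)] R"
      unfolding embeds_12_iff using p lt pos
      by (auto simp: X_def Y_def strict_mono_coarse_line) (auto simp: coarse_line_def)
    then show "contains R" unfolding contains_def by blast
  next
    assume "contains R"
    then obtain \<alpha> \<beta> where e: "strict_mono \<alpha>" "strict_mono \<beta>" "\<alpha> 0 = 0" "\<beta> 0 = 0"
       "\<alpha> 3 = Suc (length \<pi>)" "\<beta> 3 = Suc (length \<pi>)"
       "(\<alpha> 1, \<beta> 1) \<in> plot \<pi>" "(\<alpha> 2, \<beta> 2) \<in> plot \<pi>" "\<forall>c \<in> set R. box \<alpha> \<beta> c \<inter> plot \<pi> = {}"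
      unfolding contains_def embeds_12_iff by blast
    have "is_occurrence ([1, 2], set R) \<pi> {(\<alpha> 1, \<beta> 1), (\<alpha> 2, \<beta> 2)}"
      unfolding is_occurrence_def prod.case Let_def occurrence_points_12 s l box_eq
    proof (rule conjI, goal_cases)
      case 1
      show ?case using e(7,8) by simp
    next
      case 2
      show ?case
      proof (rule exI[of _ \<alpha>], rule exI[of _ \<beta>], intro conjI)
        show "\<alpha> ` {1, 2} \<subseteq> {1..length \<pi>}" "\<beta> ` {1, 2} \<subseteq> {1..length \<pi>}"
          using e(7,8) bounded by auto
        show "mono_on {1, 2} \<alpha>" "inj_on \<alpha> {1, 2}" "mono_on {1, 2} \<beta>" "inj_on \<beta> {1, 2}"
          using e(1,2) by (simp_all add: monotone_on_def inj_on_def strict_mono_less_eq strict_mono_eq)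
      qed (use e in auto)
    qed
    then show "\<exists>\<omega>. is_occurrence ([1, 2], set R) \<pi> \<omega>" by blast
  qed
  then show ?thesis by (simp add: avoids_def)
qed

section \<open>Deciding containment\<close>

text \<open>A coordinate on a line is counted to the strip on its right. The function is applied to
  points other than the two chosen ones, whose coordinates never lie on these lines.\<close>

definition position :: "nat \<Rightarrow> nat \<Rightarrow> nat \<Rightarrow> nat" where
  "position a b x = (if x < a then 0 else if x < b then 1 else 2)"

definition cell_of :: "cell \<Rightarrow> cell \<Rightarrow> cell \<Rightarrow> cell" where
  "cell_of a b z = (position (fst a) (fst b) (fst z), position (snd a) (snd b) (snd z))"

text \<open>The quantifier over line functions becomes one over pairs of plot points, because a grid
  of the pattern 12 is determined by its two points up to irrelevant lines. For a concrete
  permutation the right-hand side can be evaluated.\<close>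

lemma (in plot_avoiding_321) contains_iff_cell_of:
  assumes R: "set R \<subseteq> set cells"
  shows "contains R \<longleftrightarrow> (\<exists>a \<in> P. \<exists>b \<in> P. fst a < fst b \<and> snd a < snd b \<and>
    (\<forall>z \<in> P. z \<noteq> a \<and> z \<noteq> b \<longrightarrow> cell_of a b z \<notin> set R))"
proof
  assume "contains R"
  then obtain \<alpha> \<beta> where e: "strict_mono \<alpha>" "strict_mono \<beta>" "\<alpha> 0 = 0" "\<beta> 0 = 0" "\<alpha> 3 = N" "\<beta> 3 = N"
      "(\<alpha> 1, \<beta> 1) \<in> P" "(\<alpha> 2, \<beta> 2) \<in> P" "\<forall>c \<in> set R. box \<alpha> \<beta> c \<inter> P = {}"
    unfolding contains_def embeds_12_iff by blast
  let ?a = "(\<alpha> 1, \<beta> 1)" and ?b = "(\<alpha> 2, \<beta> 2)"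
  have "cell_of ?a ?b z \<notin> set R" if z: "z \<in> P" "z \<noteq> ?a" "z \<noteq> ?b" for z
  proof -
    obtain x y where xy: "z = (x, y)" by (cases z)
    have ne: "x \<noteq> \<alpha> 1" "x \<noteq> \<alpha> 2" "y \<noteq> \<beta> 1" "y \<noteq> \<beta> 2"
      using z e(7,8) unique_fst unique_snd unfolding xy by blast+
    have b: "0 < x" "x < N" "0 < y" "y < N" using z(1) bounded unfolding xy by auto
    have "z \<in> box \<alpha> \<beta> (cell_of ?a ?b z)"
      using ne b e(3-6) unfolding xy
      by (auto simp: cell_of_def position_def mem_box_iff numeral_2_eq_2[symmetric]
        numeral_3_eq_3[symmetric])
    then show ?thesis using e(9) z(1) by blast
  qed
  then show "\<exists>a \<in> P. \<exists>b \<in> P. fst a < fst b \<and> snd a < snd b \<and>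
    (\<forall>z \<in> P. z \<noteq> a \<and> z \<noteq> b \<longrightarrow> cell_of a b z \<notin> set R)"
    using e(1,2,7,8) by (intro bexI[of _ ?a] bexI[of _ ?b]) (auto simp: strict_mono_less)
next
  assume "\<exists>a \<in> P. \<exists>b \<in> P. fst a < fst b \<and> snd a < snd b \<and>
    (\<forall>z \<in> P. z \<noteq> a \<and> z \<noteq> b \<longrightarrow> cell_of a b z \<notin> set R)"
  then obtain a1 a2 b1 b2 where ab: "(a1, a2) \<in> P" "(b1, b2) \<in> P" "a1 < b1" "a2 < b2"
    and notin: "\<And>z. z \<in> P \<Longrightarrow> z \<noteq> (a1, a2) \<Longrightarrow> z \<noteq> (b1, b2) \<Longrightarrow> cell_of (a1, a2) (b1, b2) z \<notin> set R"
    by fastforce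
  define X where "X = coarse_line a1 b1 N"
  define Y where "Y = coarse_line a2 b2 N"
  have pos: "0 < a1" "0 < a2" "b1 < N" "b2 < N" using ab bounded by auto
  have "box X Y c \<inter> P = {}" if c: "c \<in> set R" for c
  proof (rule ccontr)
    assume "\<not> ?thesis"
    then obtain x y where z: "(x, y) \<in> P" "(x, y) \<in> box X Y c" by auto
    have "c \<in> {0, 1, 2} \<times> {0, 1, 2}" using c R set_cells by blast
    then have "(x, y) \<noteq> (a1, a2) \<and> (x, y) \<noteq> (b1, b2) \<and> cell_of (a1, a2) (b1, b2) (x, y) = c"
      using z(2) ab(3,4)
      by (auto simp: box_def X_def Y_def coarse_line_def cell_of_def position_def)
    then show False using notin[OF z(1)] c by auto
  qed
  then have "embeds X Y [(1, 1), (2, 2)] R"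
    unfolding embeds_12_iff using ab pos
    by (auto simp: X_def Y_def strict_mono_coarse_line) (auto simp: coarse_line_def)
  then show "contains R" unfolding contains_def by blast
qed

definition points :: "nat list \<Rightarrow> cell list" where
  "points \<pi> = zip [1..<Suc (length \<pi>)] \<pi>"

lemma set_points: "set (points \<pi>) = plot \<pi>"
proof (intro set_eqI iffI)
  fix z assume "z \<in> set (points \<pi>)"
  then obtain k where "k < length \<pi>" "z = (Suc k, \<pi> ! k)"
    by (auto simp: points_def in_set_conv_nth simp del: upt_Suc)
  then show "z \<in> plot \<pi>" by (cases z) (auto simp: mem_plot_iff)
next
  fix z assume "z \<in> plot \<pi>"
  then obtain i where i: "z = (i, \<pi> ! (i - 1))" "1 \<le> i" "i \<le> length \<pi>"
    by (auto simp: plot_def)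
  then have "points \<pi> ! (i - 1) = z" "i - 1 < length (points \<pi>)"
    by (auto simp: points_def simp del: upt_Suc)
  then show "z \<in> set (points \<pi>)" by (metis nth_mem)
qed

text \<open>One list for each increasing pair of points: the cells that the remaining points occupy
  relative to the pair. It does not depend on R, so each test permutation needs it once for all
  patterns.\<close>

definition profile :: "nat list \<Rightarrow> cell list list" where
  "profile \<pi> = (let ps = points \<pi> in
     concat (map (\<lambda>a. map (\<lambda>b. map (cell_of a b) (filter (\<lambda>z. z \<noteq> a \<and> z \<noteq> b) ps))
       (filter (\<lambda>b. fst a < fst b \<and> snd a < snd b) ps)) ps))"

definition hits :: "cell list list \<Rightarrow> cell list \<Rightarrow> bool" where
  "hits F R \<longleftrightarrow> list_ex (list_all (\<lambda>c. c \<notin> set R)) F"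

lemma avoids_12_iff_hits:
  assumes "avoids_321 \<pi>" "set R \<subseteq> set cells"
  shows "avoids \<pi> ([1, 2], set R) \<longleftrightarrow> \<not> hits (profile \<pi>) R"
proof -
  interpret plot_avoiding_321 "plot \<pi>" "Suc (length \<pi>)"
    using assms(1) by (rule plot_avoiding_321_plot)
  have ex_concat: "(\<exists>x \<in> set (concat (map f xs)). Q x) \<longleftrightarrow> (\<exists>a \<in> set xs. \<exists>x \<in> set (f a). Q x)"
    for f :: "cell \<Rightarrow> cell list list" and xs Q by auto
  have ex_map: "(\<exists>x \<in> set (map f (filter q xs)). Q x) \<longleftrightarrow> (\<exists>a \<in> set xs. q a \<and> Q (f a))"
    for f :: "cell \<Rightarrow> cell list" and q xs Q by auto
  have all_map: "(\<forall>x \<in> set (map f (filter q xs)). Q x) \<longleftrightarrow> (\<forall>a \<in> set xs. q a \<longrightarrow> Q (f a))"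
    for f :: "cell \<Rightarrow> cell" and q xs Q by auto
  have "hits (profile \<pi>) R \<longleftrightarrow> contains R"
    unfolding hits_def profile_def Let_def list_ex_iff list_all_iff contains_iff_cell_of[OF assms(2)]
    by (simp only: ex_concat ex_map all_map set_points conj_assoc)
  then show ?thesis unfolding avoids_12_iff[OF assms] by simp
qed

definition is_321_avoider :: "nat list \<Rightarrow> bool" where
  "is_321_avoider \<pi> \<longleftrightarrow> distinct \<pi> \<and> list_all (\<lambda>i. 1 \<le> i \<and> i \<le> length \<pi>) \<pi> \<and>
     (let ps = points \<pi> in
      list_all (\<lambda>a. list_all (\<lambda>b. if fst a < fst b \<and> snd b < snd a
        then list_all (\<lambda>c. \<not> (fst b < fst c \<and> snd c < snd b)) ps else True) ps) ps)"

lemma avoids_321_if_is_321_avoider: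
  assumes "is_321_avoider \<pi>"
  shows "avoids_321 \<pi>"
proof -
  have d: "distinct \<pi>" "set \<pi> \<subseteq> {1..length \<pi>}"
    using assms by (auto simp: is_321_avoider_def list_all_iff)
  \<comment> \<open>Distinct entries in a range of the same cardinality exhaust it.\<close>
  then have "set \<pi> = {1..length \<pi>}"
    by (intro card_subset_eq) (auto simp: distinct_card)
  with d have "is_perm \<pi>" by (simp add: is_perm_def permutations_of_set_def)
  moreover have "\<not> (x1 < x2 \<and> x2 < x3 \<and> y3 < y2 \<and> y2 < y1)"
    if "(x1, y1) \<in> plot \<pi>" "(x2, y2) \<in> plot \<pi>" "(x3, y3) \<in> plot \<pi>" for x1 y1 x2 y2 x3 y3
    using assms that by (fastforce simp: is_321_avoider_def Let_def list_all_iff set_points split: if_splits)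
  ultimately show ?thesis unfolding avoids_321_def using avoids_321_iff by blast
qed

text \<open>Patterns are split into blocks by their answers to successive tests, and success means
  that every block shrinks to at most one pattern. This avoids comparing all pairs of
  patterns.\<close>

fun separates :: "nat list list \<Rightarrow> cell list list \<Rightarrow> bool" where
  "separates ts [] = True"
| "separates ts [R] = True"
| "separates [] (R # R' # Rs) = False"
| "separates (t # ts) (R # R' # Rs) =
     (let F = profile t in
      separates ts (filter (hits F) (R # R' # Rs)) \<and>
      separates ts (filter (\<lambda>R. \<not> hits F R) (R # R' # Rs)))"

text \<open>Patterns with equal answers always enter the same block, so they are never parted and
  end up together in a block with a single entry.\<close>

lemma separates_sound:
  assumes "separates ts Rs" "R \<in> set Rs" "R' \<in> set Rs"
    "\<And>t. t \<in> set ts \<Longrightarrow> hits (profile t) R \<longleftrightarrow> hits (profile t) R'"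
  shows "R = R'"
  using assms
proof (induction ts Rs rule: separates.induct)
  case (4 t ts R1 R2 Rs)
  let ?Rs = "R1 # R2 # Rs"
  have sep: "separates ts (filter (hits (profile t)) ?Rs)"
    "separates ts (filter (\<lambda>R. \<not> hits (profile t) R) ?Rs)"
    using "4.prems"(1) unfolding separates.simps Let_def by blast+
  have agree: "hits (profile t) R \<longleftrightarrow> hits (profile t) R'"
    using "4.prems"(4) by simp
  show ?case
  proof (cases "hits (profile t) R")
    case True
    then have "R \<in> set (filter (hits (profile t)) ?Rs)" "R' \<in> set (filter (hits (profile t)) ?Rs)"
      using "4.prems"(2,3) agree unfolding set_filter by blast+
    then show ?thesis using "4.IH"(1)[OF refl sep(1)] "4.prems"(4) by simp
  next
    case False
    then have "R \<in> set (filter (\<lambda>R. \<not> hits (profile t) R) ?Rs)"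
      "R' \<in> set (filter (\<lambda>R. \<not> hits (profile t) R) ?Rs)"
      using "4.prems"(2,3) agree unfolding set_filter by blast+
    then show ?thesis using "4.IH"(2)[OF refl sep(2)] "4.prems"(4) by simp
  qed
qed auto

section \<open>The coincidences\<close>

text \<open>Each entry \<open>(H, ms, Ms)\<close> describes one of the 61 classes with more than one element: the
  minimal elements \<open>ms\<close> with certificates for the implication from \<open>m\<close> to \<open>H\<close>, and the
  maximal elements \<open>Ms\<close> with certificates for the implication from \<open>H\<close> to \<open>M\<close>. All patterns
  in between follow by monotonicity. The certificates were found by exhaustive search.\<close>

definition coincidence_table ::
    "(cell list \<times> (cell list \<times> certificate) list \<times> (cell list \<times> certificate) list) list" where
  "coincidence_table =
  [([(0,0),(0,1),(2,1),(2,2)],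
    [([], Split West (0,0) (Split West (0,1) (Split West (2,1) (Split West (2,2) (Found (1,1) (2,2)) (Split West (0,2) (Split West (3,2) (Split East (3,3) (Found (1,1) (3,3)) (Split West (0,3) (Found (1,1) (4,4)) (Found (1,4) (5,5)))) (Split East (4,3) (Split East (4,4) (Found (1,1) (4,3)) (Found (1,1) (5,5))) (Split East (5,5) (Found (1,1) (5,4)) (Found (1,1) (6,6))))) (Split East (4,3) (Split East (4,4) (Found (1,3) (4,4)) (Found (1,3) (5,5))) (Split East (5,5) (Found (1,3) (5,4)) (Found (1,3) (6,6)))))) (Split West (3,2) (Split West (3,3) (Found (1,1) (3,2)) (Split East (4,3) (Split East (4,4) (Found (1,1) (4,4)) (Found (1,1) (5,5))) (Split East (5,5) (Found (1,1) (5,4)) (Found (1,1) (6,6))))) (Split East (4,3) (Split East (4,4) (Found (1,1) (4,3)) (Found (1,1) (5,5))) (Split East (5,5) (Found (1,1) (5,4)) (Found (1,1) (6,6)))))) (Split West (3,2) (Split West (3,3) (Found (1,2) (3,3)) (Split East (4,3) (Split East (4,4) (Found (1,2) (4,4)) (Found (1,2) (5,5))) (Split East (5,5) (Found (1,2) (5,4)) (Found (1,2) (6,6))))) (Split East (4,3) (Split East (4,4) (Found (1,2) (4,3)) (Found (1,2) (5,5))) (Split East (5,5) (Found (1,2) (5,4)) (Found (1,2) (6,6)))))) (Split West (0,2) (Split West (3,1) (Split West (3,2) (Split East (3,3) (Found (1,1) (3,3)) (Split West (0,3) (Found (1,1) (4,4)) (Found (1,4) (5,5)))) (Split East (4,3)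 (Split East (4,4) (Found (1,1) (4,3)) (Found (1,1) (5,5))) (Split East (5,5) (Found (1,1) (5,4)) (Found (1,1) (6,6))))) (Split East (4,3) (Split East (4,2) (Split East (4,4) (Found (1,1) (4,2)) (Found (1,1) (5,5))) (Split East (5,5) (Found (1,1) (5,3)) (Found (1,1) (6,6)))) (Split East (5,5) (Found (1,1) (5,4)) (Found (1,1) (6,6))))) (Split East (4,3) (Split East (4,4) (Found (1,3) (4,4)) (Found (1,3) (5,5))) (Split East (5,5) (Found (1,3) (5,4)) (Found (1,3) (6,6))))))],
    [([(0,0),(0,1),(1,1),(1,2)], Split West (1,2) (Split West (1,1) (Found (1,1) (2,2)) (Found (1,1) (2,2))) (Split West (0,2) (Split West (1,1) (Found (1,1) (2,3)) (Found (1,1) (2,2))) (Split West (1,3) (Found (1,3) (3,4)) (Found (1,3) (2,4))))),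
     ([(0,0),(1,0),(1,1),(1,2)], Split West (1,0) (Split West (1,1) (Split West (1,2) (Found (1,1) (2,2)) (Found (1,1) (2,3))) (Split West (1,3) (Found (1,1) (2,2)) (Found (1,1) (2,4)))) (Split West (2,1) (Split West (2,2) (Split West (2,3) (Found (2,1) (3,3)) (Found (2,1) (3,4))) (Split West (2,4) (Found (2,1) (3,3)) (Found (2,1) (3,5)))) (Split West (2,3) (Split West (2,4) (Found (2,1) (3,2)) (Found (2,1) (3,5))) (Found (2,1) (3,4))))),
     ([(0,0),(0,1),(1,1),(2,1)], Split South (1,1) (Found (1,1) (2,2)) (Found (1,1) (2,2))),
     ([(0,0),(1,0),(1,1),(2,1)], Split West (1,0) (Split West (1,1) (Found (1,1) (2,2)) (Split West (2,1) (Found (1,1) (2,2)) (Found (1,1) (3,2)))) (Split West (2,1) (Split West (3,1) (Split South (2,2) (Found (2,1) (3,3)) (Found (2,1) (3,3))) (Found (2,1) (4,2))) (Found (2,1) (3,2)))),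
     ([(0,0),(0,1),(1,2),(2,2)], Split East (1,2) (Found (1,1) (2,2)) (Split West (0,2) (Found (1,1) (2,3)) (Found (1,3) (3,4)))),
     ([(0,0),(1,0),(1,2),(2,2)], Split West (1,0) (Split West (1,2) (Found (1,1) (2,2)) (Split East (2,3) (Found (1,1) (2,3)) (Found (1,1) (3,4)))) (Split East (2,3) (Found (2,1) (3,3)) (Found (2,1) (3,4)))),
     ([(0,1),(1,1),(1,2),(2,2)], Split East (1,2) (Split West (1,1) (Found (1,1) (2,2)) (Split North (2,2) (Found (2,2) (3,3)) (Found (3,3) (4,4)))) (Split East (1,2) (Split East (0,2) (Split North (1,1) (Found (1,1) (2,3)) (Found (2,2) (3,4))) (Found (1,3) (3,4))) (Found (2,3) (3,4)))),
     ([(1,0),(1,1),(1,2),(2,2)], Split East (1,2) (Split West (1,0) (Split West (1,1) (Found (1,1) (2,2)) (Split East (2,1) (Split East (2,2) (Found (2,2) (3,3)) (Found (3,3) (4,4))) (Split East (3,3) (Found (3,2) (4,4)) (Found (4,4) (5,5))))) (Split East (2,1) (Split East (2,2) (Found (2,1) (3,3)) (Found (3,3) (4,4))) (Split East (3,3) (Found (3,2) (4,4)) (Found (4,4) (5,5))))) (Split East (1,2) (Split East (1,0) (Split East (1,1) (Found (1,1) (2,3)) (Found (2,2) (3,4))) (Split East (2,2) (Found (2,1) (3,4)) (Found (3,3) (4,5)))) (Split East (2,1) (Split East (2,0) (Found (2,3) (3,4)) (Found (3,1) (4,5))) (Found (3,2) (4,5))))),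
     ([(0,0),(0,1),(2,1),(2,2)], Found (1,1) (2,2)),
     ([(0,0),(1,0),(2,1),(2,2)], Split West (1,0) (Found (1,1) (2,2)) (Split East (3,1) (Found (2,1) (3,3)) (Found (2,1) (4,2)))),
     ([(0,1),(1,1),(2,1),(2,2)], Split North (1,1) (Found (1,1) (2,2)) (Found (2,2) (3,3))),
     ([(1,0),(1,1),(2,1),(2,2)], Split West (1,0) (Split West (1,1) (Found (1,1) (2,2)) (Split East (2,1) (Split East (2,2) (Found (2,2) (3,3)) (Found (3,3) (4,4))) (Split East (3,3) (Found (3,2) (4,4)) (Found (4,4) (5,5))))) (Split East (3,1) (Split East (2,1) (Split East (2,2) (Found (2,1) (3,3)) (Found (3,3) (4,4))) (Split East (3,3) (Found (3,2) (4,4)) (Found (4,4) (5,5)))) (Split East (3,1) (Split East (2,1) (Found (2,1) (4,2)) (Found (3,2) (5,3))) (Found (4,2) (5,3)))))]),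
   ([(0,0),(0,1),(0,2),(1,1),(1,2)],
    [([(0,2)], Split West (0,1) (Split West (0,0) (Split West (1,1) (Split West (1,2) (Found (1,1) (2,2)) (Found (1,1) (2,3))) (Split West (1,3) (Found (1,1) (2,2)) (Found (1,1) (2,4)))) (Split West (1,1) (Found (1,1) (2,2)) (Found (1,1) (2,2)))) (Split West (0,0) (Split West (1,2) (Split West (2,2) (Split West (2,3) (Found (1,2) (3,3)) (Found (1,2) (3,4))) (Split West (2,4) (Found (1,2) (3,3)) (Found (1,2) (3,5)))) (Found (1,2) (2,3))) (Split West (1,1) (Found (1,1) (2,3)) (Found (1,1) (2,2)))))],
    [([(0,0),(0,1),(0,2),(1,1),(1,2)], Found (1,1) (2,2)),
     ([(0,0),(0,1),(0,2),(1,1),(2,1)], Split West (2,1) (Found (1,1) (2,2)) (Found (1,1) (3,2))),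
     ([(0,0),(0,1),(0,2),(1,2),(2,2)], Split North (2,2) (Found (1,1) (2,2)) (Found (1,1) (3,3))),
     ([(0,0),(0,2),(1,0),(1,2),(2,2)], Split West (1,0) (Split North (2,2) (Found (1,1) (2,2)) (Split West (2,0) (Found (1,1) (3,3)) (Found (3,1) (4,4)))) (Split North (3,3) (Found (2,1) (3,3)) (Found (2,1) (4,4)))),
     ([(0,1),(0,2),(1,1),(1,2),(2,2)], Split North (2,2) (Found (1,1) (2,2)) (Split North (2,2) (Found (2,2) (3,3)) (Found (3,3) (4,4)))),
     ([(0,2),(1,0),(1,1),(1,2),(2,2)], Split North (2,2) (Split West (1,0) (Found (1,1) (2,2)) (Split West (2,1) (Found (2,1) (3,3)) (Split East (3,2) (Found (3,2) (4,4)) (Found (4,3) (5,5))))) (Split East (2,1) (Split East (2,0) (Split East (2,2) (Found (2,2) (3,3)) (Found (3,3) (4,4))) (Split East (3,3) (Found (3,1) (4,4)) (Found (4,4) (5,5)))) (Split East (3,3) (Found (3,2) (4,4)) (Found (4,4) (5,5))))),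
     ([(0,0),(0,1),(0,2),(2,1),(2,2)], Split East (2,1) (Split East (2,2) (Found (1,1) (2,2)) (Found (1,1) (3,3))) (Split East (3,3) (Found (1,1) (3,2)) (Found (1,1) (4,4))))]),
   ([(0,0),(1,0),(1,1),(2,0),(2,1)],
    [([(2,0)], Split West (1,0) (Split West (0,0) (Split West (1,1) (Split West (2,1) (Found (1,1) (2,2)) (Found (1,1) (3,2))) (Split West (2,1) (Split West (3,1) (Found (1,1) (2,2)) (Found (1,1) (4,2))) (Found (1,1) (3,2)))) (Split West (1,0) (Split West (1,1) (Found (1,1) (2,2)) (Split West (2,1) (Found (1,1) (2,2)) (Found (1,1) (3,2)))) (Split West (2,1) (Split South (2,2) (Found (2,1) (3,3)) (Found (2,1) (3,3))) (Found (2,1) (3,2))))) (Split South (0,0) (Split West (2,1) (Split West (2,2) (Split West (3,2) (Found (2,1) (3,3)) (Found (2,1) (4,3))) (Split West (3,2) (Split West (4,2) (Found (2,1) (3,3)) (Found (2,1) (5,3))) (Found (2,1) (4,3)))) (Found (2,1) (3,2))) (Split South (1,1) (Found (1,1) (3,2)) (Found (1,1) (2,2)))))],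
    [([(0,0),(1,0),(1,1),(1,2),(2,0)], Split West (1,2) (Found (1,1) (2,2)) (Found (1,1) (2,3))),
     ([(0,0),(1,0),(1,1),(2,0),(2,1)], Found (1,1) (2,2)),
     ([(0,0),(1,0),(1,2),(2,0),(2,2)], Split East (1,2) (Split West (2,2) (Found (1,1) (2,2)) (Split North (3,3) (Found (1,1) (3,3)) (Found (1,1) (4,4)))) (Split North (3,3) (Found (1,1) (2,3)) (Found (1,1) (4,4)))),
     ([(0,0),(0,1),(2,0),(2,1),(2,2)], Split West (0,1) (Split East (2,2) (Found (1,1) (2,2)) (Split West (0,2) (Found (1,1) (3,3)) (Found (1,3) (4,4)))) (Split East (3,3) (Found (1,2) (3,3)) (Found (1,2) (4,4)))),
     ([(0,0),(1,0),(2,0),(2,1),(2,2)], Split East (2,2) (Found (1,1) (2,2)) (Found (1,1) (3,3))),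
     ([(0,1),(1,1),(2,0),(2,1),(2,2)], Split East (2,2) (Split West (0,1) (Found (1,1) (2,2)) (Split West (1,2) (Found (1,2) (3,3)) (Split East (2,3) (Found (2,3) (4,4)) (Found (3,4) (5,5))))) (Split East (1,2) (Split East (0,2) (Split West (2,2) (Found (2,2) (3,3)) (Split North (3,3) (Found (3,3) (4,4)) (Found (4,4) (5,5)))) (Split North (3,3) (Found (1,3) (4,4)) (Found (4,4) (5,5)))) (Split North (3,3) (Found (2,3) (4,4)) (Found (4,4) (5,5))))),
     ([(1,0),(1,1),(2,0),(2,1),(2,2)], Split East (2,2) (Found (1,1) (2,2)) (Split East (2,2) (Found (2,2) (3,3)) (Found (3,3) (4,4))))]),
   ([(0,1),(0,2),(2,0),(2,1)],
    [([(0,1),(0,2),(2,0)], Split West (2,1) (Found (1,1) (2,2)) (Found (1,1) (3,2))),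
     ([(0,2),(2,0),(2,1)], Split West (0,1) (Found (1,1) (2,2)) (Found (1,2) (3,3)))],
    [([(0,1),(0,2),(1,1),(2,0),(2,1)], Split West (1,1) (Found (1,1) (2,2)) (Split West (1,3) (Split West (2,1) (Split East (2,0) (Found (1,1) (2,2)) (Split South (3,3) (Split West (2,3) (Found (2,3) (4,4)) (Split East (3,4) (Found (3,4) (5,5)) (Found (4,5) (6,6)))) (Split East (2,3) (Found (2,3) (4,4)) (Found (3,4) (5,5))))) (Found (1,1) (3,2))) (Found (1,1) (3,2)))),
     ([(0,0),(0,1),(0,2),(2,0),(2,1),(2,2)], Split West (0,0) (Split East (2,2) (Found (1,1) (2,2)) (Found (1,1) (3,3))) (Split East (3,3) (Found (1,1) (3,3)) (Found (1,1) (4,4))))]),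
   ([(0,2),(1,0),(1,2),(2,0)],
    [([(0,2),(1,0),(2,0)], Split West (1,2) (Found (1,1) (2,2)) (Found (1,1) (2,3))),
     ([(0,2),(1,2),(2,0)], Split West (1,0) (Found (1,1) (2,2)) (Found (2,1) (3,3)))],
    [([(0,2),(1,0),(1,1),(1,2),(2,0)], Split West (1,1) (Found (1,1) (2,2)) (Split East (0,2) (Found (1,1) (2,2)) (Split West (3,3) (Split West (3,2) (Found (3,2) (4,4)) (Split East (4,3) (Found (4,3) (5,5)) (Found (5,4) (6,6)))) (Split East (3,2) (Found (3,2) (4,4)) (Found (4,3) (5,5)))))),
     ([(0,0),(0,2),(1,0),(1,2),(2,0),(2,2)], Split South (0,0) (Split West (2,2) (Found (1,1) (2,2)) (Split North (3,3) (Found (1,1) (3,3)) (Found (1,1) (4,4)))) (Split North (3,3) (Found (1,1) (3,3)) (Found (1,1) (4,4))))]),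
   ([(0,1),(0,2),(1,0),(1,1),(1,2),(2,0)],
    [([(0,1),(0,2),(1,0),(2,0)], Split West (1,1) (Split West (1,2) (Found (1,1) (2,2)) (Found (1,1) (2,3))) (Split West (1,3) (Found (1,1) (2,2)) (Found (1,1) (2,4))))],
    [([(0,1),(0,2),(1,0),(1,1),(1,2),(2,0)], Found (1,1) (2,2)),
     ([(0,1),(0,2),(1,0),(1,1),(2,0),(2,1)], Split West (2,1) (Found (1,1) (2,2)) (Found (1,1) (3,2))),
     ([(0,1),(0,2),(1,0),(1,2),(2,0),(2,2)], Split North (2,2) (Found (1,1) (2,2)) (Found (1,1) (3,3))),
     ([(0,1),(0,2),(1,0),(2,0),(2,1),(2,2)], Split East (2,1) (Split East (2,2) (Found (1,1) (2,2)) (Found (1,1) (3,3))) (Split East (3,3) (Found (1,1) (3,2)) (Found (1,1) (4,4))))]),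
   ([(0,0),(0,1),(0,2),(1,0),(1,1),(1,2),(2,0)],
    [([(0,0),(0,1),(0,2),(1,0),(2,0)], Split West (1,1) (Split West (1,2) (Found (1,1) (2,2)) (Found (1,1) (2,3))) (Split West (1,3) (Found (1,1) (2,2)) (Found (1,1) (2,4))))],
    [([(0,0),(0,1),(0,2),(1,0),(1,1),(1,2),(2,0)], Found (1,1) (2,2)),
     ([(0,0),(0,1),(0,2),(1,0),(1,1),(2,0),(2,1)], Split West (2,1) (Found (1,1) (2,2)) (Found (1,1) (3,2))),
     ([(0,0),(0,1),(0,2),(1,0),(1,2),(2,0),(2,2)], Split North (2,2) (Found (1,1) (2,2)) (Found (1,1) (3,3))),
     ([(0,0),(0,1),(0,2),(1,0),(2,0),(2,1),(2,2)], Split East (2,1) (Split East (2,2) (Found (1,1) (2,2)) (Found (1,1) (3,3))) (Split East (3,3) (Found (1,1) (3,2)) (Found (1,1) (4,4))))]),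
   ([(0,0),(0,1),(0,2),(1,2),(2,0),(2,1)],
    [([(0,2),(1,2),(2,0),(2,1)], Split West (0,0) (Split West (0,1) (Found (1,1) (2,2)) (Found (1,2) (3,3))) (Split West (0,2) (Found (1,1) (3,3)) (Found (1,3) (4,4))))],
    [([(0,0),(0,1),(0,2),(1,2),(2,0),(2,1)], Found (1,1) (2,2)),
     ([(0,0),(0,2),(1,0),(1,2),(2,0),(2,1)], Split West (1,0) (Found (1,1) (2,2)) (Found (2,1) (3,3))),
     ([(0,1),(0,2),(1,1),(1,2),(2,0),(2,1)], Split North (1,1) (Found (1,1) (2,2)) (Found (2,2) (3,3))),
     ([(0,2),(1,0),(1,1),(1,2),(2,0),(2,1)], Split East (1,0) (Split East (1,1) (Found (1,1) (2,2)) (Found (2,2) (3,3))) (Split East (2,2) (Found (2,1) (3,3)) (Found (3,3) (4,4))))]),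
   ([(0,0),(0,1),(0,2),(1,2),(2,0),(2,1),(2,2)],
    [([(0,2),(1,2),(2,0),(2,1),(2,2)], Split West (0,0) (Split West (0,1) (Found (1,1) (2,2)) (Found (1,2) (3,3))) (Split West (0,2) (Found (1,1) (3,3)) (Found (1,3) (4,4))))],
    [([(0,0),(0,1),(0,2),(1,2),(2,0),(2,1),(2,2)], Found (1,1) (2,2)),
     ([(0,0),(0,2),(1,0),(1,2),(2,0),(2,1),(2,2)], Split West (1,0) (Found (1,1) (2,2)) (Found (2,1) (3,3))),
     ([(0,1),(0,2),(1,1),(1,2),(2,0),(2,1),(2,2)], Split North (1,1) (Found (1,1) (2,2)) (Found (2,2) (3,3))),
     ([(0,2),(1,0),(1,1),(1,2),(2,0),(2,1),(2,2)], Split East (1,0) (Split East (1,1) (Found (1,1) (2,2)) (Found (2,2) (3,3))) (Split East (2,2) (Found (2,1) (3,3)) (Found (3,3) (4,4))))]),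
   ([(0,0),(0,2),(2,0)],
    [([(0,2),(2,0)], Split West (0,0) (Found (1,1) (2,2)) (Found (1,1) (3,3)))],
    [([(0,2),(1,1),(2,0)], Split West (1,1) (Found (1,1) (2,2)) (Split East (0,2) (Split East (2,0) (Found (1,1) (2,2)) (Split West (3,2) (Split South (3,3) (Split West (2,4) (Found (3,1) (4,4)) (Split East (2,3) (Found (2,3) (5,4)) (Found (3,4) (6,5)))) (Split West (5,2) (Split West (5,3) (Split East (2,3) (Found (2,3) (4,4)) (Found (3,4) (5,5))) (Found (3,1) (4,5))) (Found (1,2) (6,3)))) (Found (1,2) (4,3)))) (Split West (3,3) (Split West (4,2) (Found (1,3) (4,4)) (Split East (3,2) (Found (3,2) (4,5)) (Found (4,3) (5,6)))) (Split West (2,5) (Split West (3,5) (Split East (3,2) (Found (3,2) (4,4)) (Found (4,3) (5,5))) (Found (1,3) (5,4))) (Found (1,3) (5,4)))))),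
     ([(0,0),(0,2),(2,0),(2,2)], Split East (2,2) (Found (1,1) (2,2)) (Found (1,1) (3,3)))]),
   ([(0,1),(0,2),(1,0),(1,1)],
    [([(0,1),(0,2),(1,0)], Split West (1,1) (Found (1,1) (2,2)) (Found (1,1) (2,2)))],
    [([(0,1),(0,2),(1,0),(1,1),(1,2)], Split West (1,2) (Found (1,1) (2,2)) (Found (1,1) (2,3)))]),
   ([(0,0),(0,1),(0,2),(1,0),(1,1)],
    [([(0,0),(0,1),(0,2),(1,0)], Split West (1,1) (Found (1,1) (2,2)) (Found (1,1) (2,2)))],
    [([(0,0),(0,1),(0,2),(1,0),(1,1),(1,2)], Split West (1,2) (Found (1,1) (2,2)) (Found (1,1) (2,3)))]),
   ([(0,1),(1,0),(1,1),(2,0)],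
    [([(0,1),(1,0),(2,0)], Split West (1,1) (Found (1,1) (2,2)) (Found (1,1) (2,2)))],
    [([(0,1),(1,0),(1,1),(2,0),(2,1)], Split West (2,1) (Found (1,1) (2,2)) (Found (1,1) (3,2)))]),
   ([(0,0),(0,1),(1,0),(1,1),(2,0)],
    [([(0,0),(0,1),(1,0),(2,0)], Split West (1,1) (Found (1,1) (2,2)) (Found (1,1) (2,2)))],
    [([(0,0),(0,1),(1,0),(1,1),(2,0),(2,1)], Split West (2,1) (Found (1,1) (2,2)) (Found (1,1) (3,2)))]),
   ([(0,0),(0,1),(0,2),(1,2),(2,0)],
    [([(0,1),(0,2),(1,2),(2,0)], Split West (0,0) (Found (1,1) (2,2)) (Found (1,1) (3,3)))],
    [([(0,0),(0,1),(0,2),(1,2),(2,0),(2,2)], Split North (2,2) (Found (1,1) (2,2)) (Found (1,1) (3,3)))]),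
   ([(0,1),(0,2),(1,2),(2,1)],
    [([(0,2),(1,2),(2,1)], Split West (0,1) (Found (1,1) (2,2)) (Found (1,2) (3,3)))],
    [([(0,1),(0,2),(1,1),(1,2),(2,1)], Split North (1,1) (Found (1,1) (2,2)) (Found (2,2) (3,3)))]),
   ([(0,0),(0,2),(1,0),(2,0),(2,1)],
    [([(0,2),(1,0),(2,0),(2,1)], Split South (0,0) (Found (1,1) (2,2)) (Found (1,1) (3,3)))],
    [([(0,0),(0,2),(1,0),(2,0),(2,1),(2,2)], Split East (2,2) (Found (1,1) (2,2)) (Found (1,1) (3,3)))]),
   ([(1,0),(1,2),(2,0),(2,1)],
    [([(1,2),(2,0),(2,1)], Split West (1,0) (Found (1,1) (2,2)) (Found (2,1) (3,3)))],
    [([(1,0),(1,1),(1,2),(2,0),(2,1)], Split East (1,1) (Found (1,1) (2,2)) (Found (2,2) (3,3)))]),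
   ([(0,1),(0,2),(1,2),(2,1),(2,2)],
    [([(0,2),(1,2),(2,1),(2,2)], Split West (0,1) (Found (1,1) (2,2)) (Found (1,2) (3,3)))],
    [([(0,1),(0,2),(1,1),(1,2),(2,1),(2,2)], Split North (1,1) (Found (1,1) (2,2)) (Found (2,2) (3,3)))]),
   ([(1,0),(1,2),(2,0),(2,1),(2,2)],
    [([(1,2),(2,0),(2,1),(2,2)], Split West (1,0) (Found (1,1) (2,2)) (Found (2,1) (3,3)))],
    [([(1,0),(1,1),(1,2),(2,0),(2,1),(2,2)], Split East (1,1) (Found (1,1) (2,2)) (Found (2,2) (3,3)))]),
   ([(0,1),(1,0)],
    [([(0,1),(1,0)], Found (1,1) (2,2))],
    [([(0,1),(1,0),(1,1)], Split West (1,1) (Found (1,1) (2,2)) (Found (1,1) (2,2)))]),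
   ([(0,0),(0,1),(1,0)],
    [([(0,0),(0,1),(1,0)], Found (1,1) (2,2))],
    [([(0,0),(0,1),(1,0),(1,1)], Split West (1,1) (Found (1,1) (2,2)) (Found (1,1) (2,2)))]),
   ([(0,0),(0,2),(1,0),(1,1)],
    [([(0,0),(0,2),(1,0),(1,1)], Found (1,1) (2,2))],
    [([(0,0),(0,2),(1,0),(1,1),(1,2)], Split West (1,2) (Found (1,1) (2,2)) (Found (1,1) (2,3)))]),
   ([(0,1),(1,0),(1,2)],
    [([(0,1),(1,0),(1,2)], Found (1,1) (2,2))],
    [([(0,1),(1,0),(1,1),(1,2)], Split West (1,1) (Found (1,1) (2,2)) (Found (1,1) (2,2)))]),
   ([(0,0),(0,1),(1,0),(1,2)],
    [([(0,0),(0,1),(1,0),(1,2)], Found (1,1) (2,2))],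
    [([(0,0),(0,1),(1,0),(1,1),(1,2)], Split West (1,1) (Found (1,1) (2,2)) (Found (1,1) (2,2)))]),
   ([(0,0),(0,1),(1,1),(2,0)],
    [([(0,0),(0,1),(1,1),(2,0)], Found (1,1) (2,2))],
    [([(0,0),(0,1),(1,1),(2,0),(2,1)], Split West (2,1) (Found (1,1) (2,2)) (Found (1,1) (3,2)))]),
   ([(0,0),(0,1),(0,2),(1,1),(2,0)],
    [([(0,0),(0,1),(0,2),(1,1),(2,0)], Found (1,1) (2,2))],
    [([(0,0),(0,1),(0,2),(1,1),(2,0),(2,1)], Split West (2,1) (Found (1,1) (2,2)) (Found (1,1) (3,2)))]),
   ([(0,0),(0,2),(1,0),(1,1),(2,0)],
    [([(0,0),(0,2),(1,0),(1,1),(2,0)], Found (1,1) (2,2))],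
    [([(0,0),(0,2),(1,0),(1,1),(1,2),(2,0)], Split West (1,2) (Found (1,1) (2,2)) (Found (1,1) (2,3)))]),
   ([(0,1),(1,0),(1,2),(2,0)],
    [([(0,1),(1,0),(1,2),(2,0)], Found (1,1) (2,2))],
    [([(0,1),(1,0),(1,1),(1,2),(2,0)], Split West (1,1) (Found (1,1) (2,2)) (Found (1,1) (2,2)))]),
   ([(0,0),(0,1),(1,0),(1,2),(2,0)],
    [([(0,0),(0,1),(1,0),(1,2),(2,0)], Found (1,1) (2,2))],
    [([(0,0),(0,1),(1,0),(1,1),(1,2),(2,0)], Split West (1,1) (Found (1,1) (2,2)) (Found (1,1) (2,2)))]),
   ([(0,1),(0,2),(1,1),(1,2),(2,0)],
    [([(0,1),(0,2),(1,1),(1,2),(2,0)], Found (1,1) (2,2)),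
     ([(0,2),(1,0),(1,1),(2,0),(2,1)], Split East (0,1) (Split West (1,2) (Found (1,1) (2,2)) (Found (1,1) (2,3))) (Split West (2,3) (Found (1,2) (3,3)) (Found (1,2) (3,4))))],
    [([(0,1),(0,2),(1,1),(1,2),(2,0)], Found (1,1) (2,2)),
     ([(0,2),(1,0),(1,1),(2,0),(2,1)], Split East (1,0) (Split West (2,1) (Found (1,1) (2,2)) (Found (1,1) (3,2))) (Split West (3,2) (Found (2,1) (3,3)) (Found (2,1) (4,3))))]),
   ([(0,1),(1,0),(2,1)],
    [([(0,1),(1,0),(2,1)], Found (1,1) (2,2))],
    [([(0,1),(1,0),(1,1),(2,1)], Split South (1,1) (Found (1,1) (2,2)) (Found (1,1) (2,2)))]),
   ([(0,0),(0,1),(1,0),(2,1)],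
    [([(0,0),(0,1),(1,0),(2,1)], Found (1,1) (2,2))],
    [([(0,0),(0,1),(1,0),(1,1),(2,1)], Split South (1,1) (Found (1,1) (2,2)) (Found (1,1) (2,2)))]),
   ([(0,1),(0,2),(1,0),(2,1)],
    [([(0,1),(0,2),(1,0),(2,1)], Found (1,1) (2,2))],
    [([(0,1),(0,2),(1,0),(1,1),(2,1)], Split South (1,1) (Found (1,1) (2,2)) (Found (1,1) (2,2)))]),
   ([(0,0),(0,1),(0,2),(1,0),(2,1)],
    [([(0,0),(0,1),(0,2),(1,0),(2,1)], Found (1,1) (2,2))],
    [([(0,0),(0,1),(0,2),(1,0),(1,1),(2,1)], Split South (1,1) (Found (1,1) (2,2)) (Found (1,1) (2,2)))]),
   ([(1,2),(2,1)],
    [([(1,2),(2,1)], Found (1,1) (2,2))],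
    [([(1,1),(1,2),(2,1)], Split East (1,1) (Found (1,1) (2,2)) (Found (2,2) (3,3)))]),
   ([(0,1),(1,2),(2,1)],
    [([(0,1),(1,2),(2,1)], Found (1,1) (2,2))],
    [([(0,1),(1,1),(1,2),(2,1)], Split North (1,1) (Found (1,1) (2,2)) (Found (2,2) (3,3)))]),
   ([(0,0),(0,2),(1,2),(2,1)],
    [([(0,0),(0,2),(1,2),(2,1)], Found (1,1) (2,2))],
    [([(0,0),(0,1),(0,2),(1,2),(2,1)], Split West (0,1) (Found (1,1) (2,2)) (Found (1,2) (3,3)))]),
   ([(1,0),(1,2),(2,1)],
    [([(1,0),(1,2),(2,1)], Found (1,1) (2,2))],
    [([(1,0),(1,1),(1,2),(2,1)], Split East (1,1) (Found (1,1) (2,2)) (Found (2,2) (3,3)))]),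
   ([(0,2),(1,0),(1,2),(2,1)],
    [([(0,2),(1,0),(1,2),(2,1)], Found (1,1) (2,2))],
    [([(0,2),(1,0),(1,1),(1,2),(2,1)], Split East (1,1) (Found (1,1) (2,2)) (Found (2,2) (3,3)))]),
   ([(0,0),(0,2),(1,1),(1,2),(2,1)],
    [([(0,0),(0,2),(1,1),(1,2),(2,1)], Found (1,1) (2,2))],
    [([(0,0),(0,1),(0,2),(1,1),(1,2),(2,1)], Split West (0,1) (Found (1,1) (2,2)) (Split West (1,2) (Found (1,2) (3,3)) (Found (1,2) (2,3))))]),
   ([(0,0),(1,2),(2,0),(2,1)],
    [([(0,0),(1,2),(2,0),(2,1)], Found (1,1) (2,2))],
    [([(0,0),(1,0),(1,2),(2,0),(2,1)], Split West (1,0) (Found (1,1) (2,2)) (Found (2,1) (3,3)))]),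
   ([(0,1),(1,2),(2,0),(2,1)],
    [([(0,1),(1,2),(2,0),(2,1)], Found (1,1) (2,2))],
    [([(0,1),(1,1),(1,2),(2,0),(2,1)], Split North (1,1) (Found (1,1) (2,2)) (Found (2,2) (3,3)))]),
   ([(0,0),(1,1),(1,2),(2,0),(2,1)],
    [([(0,0),(1,1),(1,2),(2,0),(2,1)], Found (1,1) (2,2))],
    [([(0,0),(1,0),(1,1),(1,2),(2,0),(2,1)], Split West (1,0) (Found (1,1) (2,2)) (Split West (2,1) (Found (2,1) (3,3)) (Found (2,1) (3,2))))]),
   ([(0,1),(0,2),(1,0),(2,2)],
    [([(0,1),(0,2),(1,0),(2,2)], Found (1,1) (2,2))],
    [([(0,1),(0,2),(1,0),(1,2),(2,2)], Split East (1,2) (Found (1,1) (2,2)) (Found (1,1) (2,3)))]),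
   ([(0,0),(0,1),(0,2),(1,0),(2,2)],
    [([(0,0),(0,1),(0,2),(1,0),(2,2)], Found (1,1) (2,2))],
    [([(0,0),(0,1),(0,2),(1,0),(1,2),(2,2)], Split East (1,2) (Found (1,1) (2,2)) (Found (1,1) (2,3)))]),
   ([(0,1),(0,2),(1,0),(1,1),(2,2)],
    [([(0,1),(0,2),(1,0),(1,1),(2,2)], Found (1,1) (2,2))],
    [([(0,1),(0,2),(1,0),(1,1),(1,2),(2,2)], Split East (1,2) (Found (1,1) (2,2)) (Split East (1,2) (Found (1,1) (2,3)) (Found (2,3) (3,4))))]),
   ([(0,1),(1,0),(2,0),(2,2)],
    [([(0,1),(1,0),(2,0),(2,2)], Found (1,1) (2,2))],
    [([(0,1),(1,0),(2,0),(2,1),(2,2)], Split East (2,1) (Found (1,1) (2,2)) (Found (1,1) (3,2)))]),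
   ([(0,0),(0,1),(1,0),(2,0),(2,2)],
    [([(0,0),(0,1),(1,0),(2,0),(2,2)], Found (1,1) (2,2))],
    [([(0,0),(0,1),(1,0),(2,0),(2,1),(2,2)], Split East (2,1) (Found (1,1) (2,2)) (Found (1,1) (3,2)))]),
   ([(0,1),(1,0),(1,1),(2,0),(2,2)],
    [([(0,1),(1,0),(1,1),(2,0),(2,2)], Found (1,1) (2,2))],
    [([(0,1),(1,0),(1,1),(2,0),(2,1),(2,2)], Split East (2,1) (Found (1,1) (2,2)) (Split East (2,1) (Found (1,1) (3,2)) (Found (3,2) (4,3))))]),
   ([(1,1),(1,2),(2,0),(2,2)],
    [([(1,1),(1,2),(2,0),(2,2)], Found (1,1) (2,2))],
    [([(1,0),(1,1),(1,2),(2,0),(2,2)], Split East (1,0) (Found (1,1) (2,2)) (Found (2,1) (3,3)))]),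
   ([(0,2),(1,1),(1,2),(2,0),(2,2)],
    [([(0,2),(1,1),(1,2),(2,0),(2,2)], Found (1,1) (2,2))],
    [([(0,2),(1,0),(1,1),(1,2),(2,0),(2,2)], Split East (1,0) (Found (1,1) (2,2)) (Found (2,1) (3,3)))]),
   ([(0,2),(1,1),(2,1),(2,2)],
    [([(0,2),(1,1),(2,1),(2,2)], Found (1,1) (2,2))],
    [([(0,1),(0,2),(1,1),(2,1),(2,2)], Split East (0,1) (Found (1,1) (2,2)) (Found (1,2) (3,3)))]),
   ([(1,2),(2,1),(2,2)],
    [([(1,2),(2,1),(2,2)], Found (1,1) (2,2))],
    [([(1,1),(1,2),(2,1),(2,2)], Split East (1,1) (Found (1,1) (2,2)) (Found (2,2) (3,3)))]),
   ([(0,1),(1,2),(2,1),(2,2)],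
    [([(0,1),(1,2),(2,1),(2,2)], Found (1,1) (2,2))],
    [([(0,1),(1,1),(1,2),(2,1),(2,2)], Split North (1,1) (Found (1,1) (2,2)) (Found (2,2) (3,3)))]),
   ([(0,0),(0,2),(1,2),(2,1),(2,2)],
    [([(0,0),(0,2),(1,2),(2,1),(2,2)], Found (1,1) (2,2))],
    [([(0,0),(0,1),(0,2),(1,2),(2,1),(2,2)], Split West (0,1) (Found (1,1) (2,2)) (Found (1,2) (3,3)))]),
   ([(1,0),(1,2),(2,1),(2,2)],
    [([(1,0),(1,2),(2,1),(2,2)], Found (1,1) (2,2))],
    [([(1,0),(1,1),(1,2),(2,1),(2,2)], Split East (1,1) (Found (1,1) (2,2)) (Found (2,2) (3,3)))]),
   ([(0,2),(1,0),(1,2),(2,1),(2,2)],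
    [([(0,2),(1,0),(1,2),(2,1),(2,2)], Found (1,1) (2,2))],
    [([(0,2),(1,0),(1,1),(1,2),(2,1),(2,2)], Split East (1,1) (Found (1,1) (2,2)) (Found (2,2) (3,3)))]),
   ([(0,2),(1,1),(2,0),(2,1),(2,2)],
    [([(0,2),(1,1),(2,0),(2,1),(2,2)], Found (1,1) (2,2))],
    [([(0,1),(0,2),(1,1),(2,0),(2,1),(2,2)], Split East (0,1) (Found (1,1) (2,2)) (Found (1,2) (3,3)))]),
   ([(0,0),(1,2),(2,0),(2,1),(2,2)],
    [([(0,0),(1,2),(2,0),(2,1),(2,2)], Found (1,1) (2,2))],
    [([(0,0),(1,0),(1,2),(2,0),(2,1),(2,2)], Split West (1,0) (Found (1,1) (2,2)) (Found (2,1) (3,3)))]),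
   ([(0,1),(1,2),(2,0),(2,1),(2,2)],
    [([(0,1),(1,2),(2,0),(2,1),(2,2)], Found (1,1) (2,2))],
    [([(0,1),(1,1),(1,2),(2,0),(2,1),(2,2)], Split North (1,1) (Found (1,1) (2,2)) (Found (2,2) (3,3)))])]"

text \<open>The arguments are in the order of the implication, from R to R'. A separate constant
  keeps \<open>certifies\<close> folded while the table is searched.\<close>

definition certified :: "cell list \<Rightarrow> cell list \<Rightarrow> certificate \<Rightarrow> bool" where
  "certified R R' t \<longleftrightarrow> certifies R' [(1, 1), (2, 2)] R t"

text \<open>All coincidences rest on this finite check. As an example, take the shading {(0,2),
  (2,0)} and its extension by (0,0): if box (0,0) is empty, the occurrence serves already; if not,
  its leftmost point replaces the lower point of the occurrence, and nothing is left in the new box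
  (0,0).\<close>

lemma certified_coincidence_table:
  "list_all (\<lambda>(H, ms, Ms).
     list_all (\<lambda>(m, t). certified m H t) ms \<and> list_all (\<lambda>(M, t). certified H M t) Ms)
   coincidence_table"
  by code_simp

section \<open>Normal forms of patterns\<close>

definition coincidence_ranges :: "(cell list \<times> cell list list \<times> cell list list) list" where
  "coincidence_ranges = map (\<lambda>(H, ms, Ms). (H, map fst ms, map fst Ms)) coincidence_table"

text \<open>Shadings are sublists of \<open>cells\<close>, so inclusion can be tested by
  \<open>subseq\<close> on lists in this fixed order. The conditional skips the maximal elements
  when no minimal one lies below R.\<close>

definition in_range :: "cell list \<Rightarrow> cell list \<times> cell list list \<times> cell list list \<Rightarrow> bool" where
  "in_range R = (\<lambda>(H, ms, Ms).
     if list_ex (\<lambda>m. subseq m R) ms then list_ex (\<lambda>M. subseq R M) Ms else False)"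

definition normal_form ::
    "(cell list \<times> cell list list \<times> cell list list) list \<Rightarrow> cell list \<Rightarrow> cell list" where
  "normal_form T R = (case List.find (in_range R) T of None \<Rightarrow> R | Some e \<Rightarrow> fst e)"

lemma set_mono_subseq: "subseq xs ys \<Longrightarrow> set xs \<subseteq> set ys"
  by (auto dest: list_emb_set)

text \<open>A circle of implications: containment passes from R to m by monotonicity, to H and on to
  M by certificates, and back to R by monotonicity.\<close>

lemma (in plot_avoiding_321) contains_normal_form:
  "contains (normal_form coincidence_ranges R) \<longleftrightarrow> contains R"
proof (cases "List.find (in_range R) coincidence_ranges")
  case None
  then show ?thesis by (simp add: normal_form_def)
next
  case (Some e)
  then have "e \<in> set coincidence_ranges" and range: "in_range R e"
    by (auto simp: find_Some_iff in_set_conv_nth)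
  then obtain H ms Ms where entry: "(H, ms, Ms) \<in> set coincidence_table"
    and e: "e = (H, map fst ms, map fst Ms)"
    by (auto simp: coincidence_ranges_def)
  from range obtain m t M t' where m: "(m, t) \<in> set ms" "subseq m R" and M: "(M, t') \<in> set Ms" "subseq R M"
    by (auto simp: in_range_def e list_ex_iff split: if_splits)
  have "certified m H t" "certified H M t'"
    using certified_coincidence_table entry m M by (fastforce simp: list_all_iff)+
  then have "contains m \<Longrightarrow> contains H" "contains H \<Longrightarrow> contains M"
    unfolding certified_def by (blast intro: contains_if_certifies)+
  moreover have "contains R \<Longrightarrow> contains m" "contains M \<Longrightarrow> contains R"
    using m M by (blast intro: contains_mono dest: set_mono_subseq)+
  ultimately show ?thesis using Some by (auto simp: normal_form_def e)
qed

definition test_permutations :: "nat list list" where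
  "test_permutations =
  [[2,3,1], [3,1,2], [1,3,2,4], [1,3,2], [2,3,1,4], [4,1,5,2,3],
   [2,4,5,1,3], [3,1,2,5,4], [2,1,3,5,4], [1,3,4,2], [1,2,5,3,4], [2,4,1,3],
   [4,1,2,5,3], [1,4,2,3], [3,1,5,2,4], [3,1,2,4], [2,1,3,4], [1,4,5,2,3],
   [2,3,5,1,4], [2,4,1,5,3], [2,1,3]]"

lemma test_permutations_avoid_321:
  assumes "\<pi> \<in> set test_permutations"
  shows "avoids_321 \<pi>"
proof -
  have "list_all is_321_avoider test_permutations" by code_simp
  with assms show ?thesis by (auto simp: list_all_iff intro: avoids_321_if_is_321_avoider)
qed

definition normal_forms :: "cell list list" where
  "normal_forms = filter (\<lambda>R. normal_form coincidence_ranges R = R) (subseqs cells)"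

text \<open>The facts are evaluated together so that the table and the filtered list are shared. The
  last one says that the chosen representatives are their own normal forms; without it a normal form
  could fail to be in the list of 213.\<close>

lemma normal_forms_check:
  "let T = coincidence_ranges; Rs = filter (\<lambda>R. normal_form T R = R) (subseqs cells) in
     length Rs = 213 \<and> separates test_permutations Rs \<and>
     list_all (\<lambda>e. subseq (fst e) cells \<and> normal_form T (fst e) = fst e) T"
  by code_simp

lemma length_normal_forms: "length normal_forms = 213"
  and separates_normal_forms: "separates test_permutations normal_forms"
  and normal_form_range: "e \<in> set coincidence_ranges \<Longrightarrow>
    subseq (fst e) cells \<and> normal_form coincidence_ranges (fst e) = fst e"
  using normal_forms_check unfolding Let_def normal_forms_def list_all_iff by blast+

lemma normal_form_in_normal_forms:
  assumes "R \<in> set (subseqs cells)"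
  shows "normal_form coincidence_ranges R \<in> set normal_forms"
proof (cases "List.find (in_range R) coincidence_ranges")
  case None
  then have "normal_form coincidence_ranges R = R" by (simp add: normal_form_def)
  then show ?thesis using assms by (simp add: normal_forms_def)
next
  case (Some e)
  then have "e \<in> set coincidence_ranges" by (auto simp: find_Some_iff in_set_conv_nth)
  moreover have "normal_form coincidence_ranges R = fst e" using Some by (simp add: normal_form_def)
  ultimately show ?thesis using normal_form_range by (simp add: normal_forms_def)
qed

text \<open>Sublists of \<open>cells\<close> correspond one to one to shadings, so lists of patterns
  can be used for counting sets of patterns.\<close>

lemma distinct_map_set_subseqs_cells: "distinct (map set (subseqs cells))"
  by (rule distinct_set_subseqs) (simp add: cells_def)

section \<open>Counting patterns and classes\<close>

abbreviation pattern_12 :: "cell list \<Rightarrow> mesh_pattern" where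
  "pattern_12 R \<equiv> ([1, 2], set R)"

lemma mesh_patterns_of_12_eq: "mesh_patterns_of [1, 2] = pattern_12 ` set (subseqs cells)"
proof -
  have "{([1::nat, 2], R) | R. R \<subseteq> A} = Pair [1, 2] ` Pow A" for A :: "cell set"
    by auto
  then show ?thesis
    by (simp only: mesh_patterns_of_12 set_cells[symmetric] subseqs_powset[symmetric] image_image)
qed

lemma card_mesh_patterns_of_12: "card (mesh_patterns_of [1, 2]) = 512"
proof -
  have "inj_on pattern_12 (set (subseqs cells))"
    using distinct_map_set_subseqs_cells by (auto simp: distinct_map inj_on_def)
  then have "card (mesh_patterns_of [1, 2]) = card (set (subseqs cells))"
    unfolding mesh_patterns_of_12_eq by (rule card_image)
  also have "\<dots> = length (subseqs cells)"
    using distinct_map_set_subseqs_cells by (simp add: distinct_map distinct_card)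
  also have "\<dots> = 512" by (simp add: length_subseqs cells_def)
  finally show ?thesis .
qed

lemma subset_cells: "R \<in> set (subseqs cells) \<Longrightarrow> set R \<subseteq> set cells"
  using subseqs_powset by (metis Pow_iff image_eqI)

lemma coincide_iff:
  assumes "R \<in> set (subseqs cells)" "R' \<in> set (subseqs cells)"
  shows "(pattern_12 R, pattern_12 R') \<in> coincidence_under [3, 2, 1] (mesh_patterns_of [1, 2]) \<longleftrightarrow>
    (\<forall>\<pi>. avoids_321 \<pi> \<longrightarrow> (avoids \<pi> (pattern_12 R) \<longleftrightarrow> avoids \<pi> (pattern_12 R')))"
proof -
  have "pattern_12 R \<in> mesh_patterns_of [1, 2]" "pattern_12 R' \<in> mesh_patterns_of [1, 2]"
    using assms unfolding mesh_patterns_of_12_eq by blast+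
  then show ?thesis unfolding coincidence_under_def Av_def avoids_321_def by blast
qed

lemma coincide_normal_form:
  assumes R: "R \<in> set (subseqs cells)"
  shows "(pattern_12 R, pattern_12 (normal_form coincidence_ranges R))
    \<in> coincidence_under [3, 2, 1] (mesh_patterns_of [1, 2])"
proof -
  have nf: "normal_form coincidence_ranges R \<in> set (subseqs cells)"
    using normal_form_in_normal_forms[OF R] by (simp add: normal_forms_def)
  have "avoids \<pi> (pattern_12 R) \<longleftrightarrow> avoids \<pi> (pattern_12 (normal_form coincidence_ranges R))"
    if "avoids_321 \<pi>" for \<pi>
    using avoids_12_iff[OF that subset_cells[OF R]] avoids_12_iff[OF that subset_cells[OF nf]]
      plot_avoiding_321.contains_normal_form[OF plot_avoiding_321_plot[OF that]] by simp
  then show ?thesis using coincide_iff[OF R nf] by blast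
qed

text \<open>Coinciding patterns agree on every 321-avoiding permutation, in particular on all test
  permutations, and these separate the normal forms.\<close>

lemma coinciding_normal_forms_eq:
  assumes R: "R \<in> set normal_forms" "R' \<in> set normal_forms"
    and co: "(pattern_12 R, pattern_12 R') \<in> coincidence_under [3, 2, 1] (mesh_patterns_of [1, 2])"
  shows "R = R'"
proof (rule separates_sound[OF separates_normal_forms R])
  fix \<pi> assume "\<pi> \<in> set test_permutations"
  then have \<pi>: "avoids_321 \<pi>" by (rule test_permutations_avoid_321)
  have mem: "R \<in> set (subseqs cells)" "R' \<in> set (subseqs cells)"
    using R by (simp_all add: normal_forms_def)
  then have "avoids \<pi> (pattern_12 R) \<longleftrightarrow> avoids \<pi> (pattern_12 R')"
    using co coincide_iff \<pi> by blast
  then show "hits (profile \<pi>) R \<longleftrightarrow> hits (profile \<pi>) R'"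
    using avoids_12_iff_hits[OF \<pi>] subset_cells mem by simp
qed

theorem mainTheorem7:
  shows "card (mesh_patterns_of [1, 2]) = 512 \<and>
    equiv (mesh_patterns_of [1, 2]) (coincidence_under [3, 2, 1] (mesh_patterns_of [1, 2])) \<and>
    card (mesh_patterns_of [1, 2] // coincidence_under [3, 2, 1] (mesh_patterns_of [1, 2])) = 213"
proof (intro conjI)
  let ?M = "mesh_patterns_of [1, 2]"
  let ?r = "coincidence_under [3, 2, 1] ?M"
  let ?class = "\<lambda>R. ?r `` {pattern_12 R}"
  show "card ?M = 512" by (rule card_mesh_patterns_of_12)
  show equiv: "equiv ?M ?r"
    by (rule equivI) (auto simp: coincidence_under_def refl_on_def sym_def trans_def)
  \<comment> \<open>Every class contains a normal form, so there are at most 213 classes;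
    injectivity of \<open>?class\<close> on normal forms then gives equality.\<close>
  have "?M // ?r = ?class ` set normal_forms"
  proof -
    have "?M // ?r = ?class ` set (subseqs cells)"
      unfolding quotient_def mesh_patterns_of_12_eq by blast
    also have "\<dots> = ?class ` set normal_forms"
    proof (intro equalityI image_subsetI)
      fix R assume R: "R \<in> set (subseqs cells)"
      have "?class R = ?class (normal_form coincidence_ranges R)"
        by (rule equiv_class_eq[OF equiv coincide_normal_form[OF R]])
      then show "?class R \<in> ?class ` set normal_forms"
        using normal_form_in_normal_forms[OF R] by blast
    qed (auto simp: normal_forms_def)
    finally show ?thesis .
  qed
  moreover have "inj_on ?class (set normal_forms)"
  proof (rule inj_onI)
    fix R R' assume R: "R \<in> set normal_forms" "R' \<in> set normal_forms" and "?class R = ?class R'"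
    moreover have "pattern_12 R' \<in> ?M"
      using R unfolding mesh_patterns_of_12_eq normal_forms_def set_filter by blast
    ultimately have "(pattern_12 R, pattern_12 R') \<in> ?r"
      using eq_equiv_class[OF _ equiv] by blast
    then show "R = R'" using coinciding_normal_forms_eq R by blast
  qed
  moreover have "distinct normal_forms"
    using distinct_map_set_subseqs_cells unfolding normal_forms_def by (simp add: distinct_map)
  ultimately show "card (?M // ?r) = 213"
    using length_normal_forms by (simp add: card_image distinct_card)
qed

end
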